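(* Let $h\ge2$ be an even integer, $M=4h$, and $\alpha\in(\mathbb Z/2h\mathbb Z)^\times$. With the notation of the context, the function $\Lambda_\alpha$ is entire and $$\Lambda_\alpha(s)=\omega_\alpha\,\Lambda_{\alpha^\vee}(1-s),\qquad |\omega_\alpha|=1,\qquad \omega_\alpha\omega_{\alpha^\vee}=1 .$$ Here $M=4h$ is both the Fourier modulus and the minimal period of $b_\alpha$. For every integer $n\ge0$, $$L(-2n-1,b_\alpha)=(-1)^{n+1}C_\alpha\,\frac{(2n+1)!\,(2h)^{2n+1}}{\pi^{2n+2}}\,L(2n+2,b_{\alpha^\vee}).$$
   Context: Write $e(x)=e^{2\pi i x}$ and $T_k=k(k+1)/2$. Let $h\ge2$ be even and $M=4h$. For $\alpha\in(\mathbb Z/2h\mathbb Z)^\times$ and an odd integer $u$ representing $\alpha$, $b_\alpha:\mathbb Z\to\mathbb C$ is the $M$-periodic function $b_\alpha(2k+1):=e(uT_k/h)$, $b_\alpha(2k):=0$ ($k\in\mathbb Z$); it does not depend on the representative $u$. The dual parameter is $\alpha^\vee:=-\alpha^{-1}$ in $(\mathbb Z/2h\mathbb Z)^\times$. With the unnormalized Fourier transform $(\mathcal F f)(r):=\sum_{m\bmod M}f(m)e(mr/M)$ of $M$-periodic functions, put $C_\alpha:=(\mathcal F b_\alpha)(1)$. Equivalently, for an odd representative $u$ of $\alpha$, $U$ with $Uu\equiv1\pmod{2h}$ and $d=(u+1)/2$, $C_\alpha=e\left(\frac1{4h}-\frac{Ud^2}{2h}\right)\sum_{k\bmod2h}e\left(\frac{uk^2}{2h}\right)$.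 For $\Re(s)>1$ set $L(s,b_\alpha)=\sum_{m\ge1}b_\alpha(m)m^{-s}$, and continue it to $\mathbb C$ meromorphically via $L(s,b_\alpha)=M^{-s}\sum_{r=1}^{M}b_\alpha(r)\zeta(s,r/M)$ (Hurwitz zeta function). Define $$\Lambda_\alpha(s):=\left(\frac M\pi\right)^{s/2}\Gamma\left(\frac s2\right)L(s,b_\alpha),\qquad \omega_\alpha:=\frac{C_\alpha}{\sqrt M}.$$ *)

theory Defs
  imports "HOL-Complex_Analysis.Complex_Analysis" "HOL-Number_Theory.Residues"
begin

definition e :: "real \<Rightarrow> complex" where
  "e x = exp (2 * of_real pi * \<i> * of_real x)"

definition T :: "int \<Rightarrow> int" where
  "T k = k * (k + 1) div 2"

text \<open>
  The ring \<open>\<int>/2h\<int>\<close> is \<open>residue_ring (2 * int h)\<close>, with carrier \<open>{0..2h-1}\<close>. As \<open>2h\<close> is even, its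
  units are odd integers, so a unit \<open>\<alpha>\<close> is itself an odd representative of its class and may be
  passed to \<open>b\<close> below. By lemma \<open>b_cong\<close> any other representative gives the same function.
\<close>

definition b :: "nat \<Rightarrow> int \<Rightarrow> int \<Rightarrow> complex" where
  "b h u m = (if odd m then e (of_int (u * T ((m - 1) div 2)) / of_nat h) else 0)"

definition dual :: "nat \<Rightarrow> int \<Rightarrow> int" where
  "dual h \<alpha> =
     \<ominus>\<^bsub>residue_ring (2 * int h)\<^esub> (inv\<^bsub>residue_ring (2 * int h)\<^esub> \<alpha>)"

definition fourier :: "nat \<Rightarrow> (int \<Rightarrow> complex) \<Rightarrow> int \<Rightarrow> complex" where
  "fourier M f r = (\<Sum>m<M. f (int m) * e (of_int (int m * r) / of_nat M))"

definition C :: "nat \<Rightarrow> int \<Rightarrow> complex" where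
  "C h \<alpha> = fourier (4 * h) (b h \<alpha>) 1"

text \<open>
  For \<open>a > 0\<close>, the analytic continuation of \<open>\<Sum>n. (n + a) powr -s\<close> to \<open>\<complex> - {1}\<close>, which is unique by
  the identity theorem. The value \<open>0\<close> at the pole is the library's convention for poles; it
  only serves to make the description definite.
\<close>

definition hurwitz_zeta :: "complex \<Rightarrow> real \<Rightarrow> complex" where
  "hurwitz_zeta s a =
     (THE f. f holomorphic_on (- {1}) \<and> f 1 = 0 \<and>
        (\<forall>w. Re w > 1 \<longrightarrow> (\<lambda>n. of_real (real n + a) powr (- w)) sums f w)) s"

text \<open>
  The parameter \<open>M\<close> is a positive period of \<open>f\<close>. At \<open>s = 1\<close> the poles of the Hurwitz zeta functions
  may cancel; \<open>remove_sings\<close> then supplies the value of the continuation.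
\<close>

definition L :: "nat \<Rightarrow> (int \<Rightarrow> complex) \<Rightarrow> complex \<Rightarrow> complex" where
  "L M f s =
     (if Re s > 1 then (\<Sum>m. f (int (Suc m)) * of_nat (Suc m) powr (- s))
      else remove_sings (\<lambda>z. of_nat M powr (- z) *
             (\<Sum>r=1..M. f (int r) * hurwitz_zeta z (real r / real M))) s)"

text \<open>
  The product below is a meromorphic function, and is to be read as such: the library sets \<open>Gamma\<close>
  to \<open>0\<close> at its poles, so at \<open>s = 0, -2, -4, \<dots>\<close> the pointwise product has the wrong value
  whenever a zero of \<open>L\<close> cancels the pole. Again \<open>remove_sings\<close> inserts the limit where it exists
  (and does nothing at points of continuity).
\<close>

definition Lambda :: "nat \<Rightarrow> int \<Rightarrow> complex \<Rightarrow> complex" where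
  "Lambda h \<alpha> =
     remove_sings (\<lambda>s. of_real (real (4 * h) / pi) powr (s / 2) * Gamma (s / 2)
                         * L (4 * h) (b h \<alpha>) s)"

definition omega :: "nat \<Rightarrow> int \<Rightarrow> complex" where
  "omega h \<alpha> = C h \<alpha> / of_real (sqrt (real (4 * h)))"

definition is_period :: "(int \<Rightarrow> complex) \<Rightarrow> nat \<Rightarrow> bool" where
  "is_period f p \<longleftrightarrow> p > 0 \<and> (\<forall>m. f (m + int p) = f m)"

definition is_minimal_period :: "(int \<Rightarrow> complex) \<Rightarrow> nat \<Rightarrow> bool" where
  "is_minimal_period f p \<longleftrightarrow> is_period f p \<and> (\<forall>q. is_period f q \<longrightarrow> p \<le> q)"

lemma e_add_int: "e (x + of_int n) = e x"
proof -
  have "2 * of_real pi * \<i> * of_real (x + of_int n)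
          = 2 * of_real pi * \<i> * of_real x + of_real (of_int (2 * n) * pi) * \<i>"
    by (simp add: algebra_simps)
  thus ?thesis
    unfolding e_def exp_eq by blast
qed

lemma b_cong:
  assumes "h > 0" and "[u = v] (mod 2 * int h)"
  shows "b h u = b h v"
proof
  fix m
  obtain j where j: "u = v + 2 * int h * j"
    using assms(2) by (metis cong_iff_lin cong_sym)
  have "real_of_int (u * T k) / real h
          = real_of_int (v * T k) / real h + real_of_int (2 * j * T k)" for k
    using assms(1) by (simp add: j field_simps)
  thus "b h u m = b h v m"
    unfolding b_def by (simp only: e_add_int)
qed

end

theory Submission
  imports Defs "HOL-Probability.Probability"
begin

text \<open>
  Write \<open>M = 4h\<close> and let \<open>v\<close> be the dual of \<open>u\<close>, so that \<open>v u \<equiv> -1\<close> modulo \<open>2h\<close>. The arithmetic heart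
  is that \<open>b h u\<close> is an eigenvector of the finite Fourier transform up to duality:
  \<open>fourier M (b h u) = C h u \<sqdot> b h v\<close> (lemma \<open>fourier_b\<close>). At an odd frequency \<open>2j + 1\<close> one completes
  the square: the shift of \<open>k\<close> by \<open>a = -v j\<close> absorbs the linear phase \<open>k j / h\<close> into \<open>u T(k) / h\<close> and
  leaves the constant \<open>v T(j) / h\<close>. At an even frequency the sum vanishes, because \<open>h\<close> is even and
  so \<open>b h u\<close> changes sign under translation by \<open>2h\<close>. Applying the transform twice gives
  \<open>C h u \<sqdot> C h v = M\<close>, and Parseval's identity gives \<open>|C h u|\<^sup>2 = M\<close>.

  The analysis is Riemann's. Since \<open>b h u\<close> and \<open>b h v\<close> are even and vanish at \<open>0\<close>, Poisson summation
  in each residue class modulo \<open>M\<close> shows that the theta series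
  \<open>\<theta>\<^sub>u(t) = \<Sum>\<^sub>n\<^sub>\<ge>\<^sub>1 b\<^sub>u(n) exp (-\<pi> n\<^sup>2 t / M)\<close> satisfies \<open>\<theta>\<^sub>u(t) = \<omega>\<^sub>u t\<^sup>-\<^sup>1\<^sup>/\<^sup>2 \<theta>\<^sub>v(1/t)\<close>
  (lemma \<open>theta_b_inversion\<close>). There is no constant term on either side, so in the logarithmic variable
  \<open>x = ln t\<close> the integral of \<open>\<theta>\<^sub>u(e\<^sup>x) e\<^sup>s\<^sup>x\<^sup>/\<^sup>2\<close> over the line converges for every \<open>s\<close> and is entire in
  \<open>s\<close>; the reflection \<open>x \<mapsto> -x\<close> is the functional equation, and for \<open>Re s > 1\<close> integration term by term
  identifies the integral with \<open>\<Lambda>\<^sub>u(s)\<close> (lemma \<open>mellin_theta_b\<close>).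

  Two classical inputs are proved on the way. The Hurwitz zeta function continues to the plane without
  \<open>1\<close> (lemma \<open>hurwitz_zeta\<close>), by a recurrence that comes from Taylor expansion of
  \<open>(x+1)\<^sup>1\<^sup>-\<^sup>s - x\<^sup>1\<^sup>-\<^sup>s\<close> and telescoping. Poisson summation for Gaussians (theorem \<open>poisson_gaussian\<close>)
  follows from the uniqueness of Fourier coefficients at a point of differentiability. The identity
  theorem then shows that the continuation of \<open>L\<close> by Hurwitz zeta functions is the entire function
  \<open>(\<pi>/M)\<^sup>s\<^sup>/\<^sup>2 \<Lambda>\<^sub>u(s) / \<Gamma>(s/2)\<close>, hence that the singularities of the products defining \<open>L\<close> and \<open>Lambda\<close> are removable. The values
  at negative odd integers are the functional equation at \<open>s = -2n - 1\<close>, with the Gamma factors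
  evaluated by reflection and duplication.
\<close>

section \<open>Additive characters and the finite Fourier transform\<close>

lemma e_add: "e (x + y) = e x * e y"
  by (simp add: e_def distrib_left exp_add)

lemma e_of_int [simp]: "e (of_int n) = 1"
  using e_add_int[of 0 n] by (simp add: e_def)

lemma e_0 [simp]: "e 0 = 1"
  by (simp add: e_def)

lemma e_conv_cis: "e x = cis (2 * pi * x)"
  by (simp add: e_def cis_conv_exp mult_ac)

lemma norm_e [simp]: "norm (e x) = 1"
  by (simp add: e_conv_cis)

lemma cnj_e: "cnj (e x) = e (- x)"
  by (simp add: e_conv_cis cis_cnj)

lemma e_half: "e (1 / 2) = - 1"
  by (simp add: e_conv_cis)

lemma e_power: "e x ^ n = e (real n * x)"
  by (induction n) (simp_all add: e_add[symmetric] algebra_simps)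

lemma e_eq_1_iff: "e x = 1 \<longleftrightarrow> x \<in> \<int>"
proof
  assume "e x = 1"
  then obtain n where "2 * pi * x = of_int (2 * n) * pi"
    by (auto simp: e_def exp_eq_1)
  hence "x = of_int n" by simp
  thus "x \<in> \<int>" by simp
qed (auto elim!: Ints_cases)

lemma e_cong: "x - y = of_int n \<Longrightarrow> e x = e y"
  using e_add_int[of y n] by (simp add: algebra_simps)

text \<open>
  Characters of \<open>\<int>/M\<int>\<close> are orthogonal: a geometric sum of an \<open>M\<close>-th root of unity.
\<close>
lemma sum_e_orthogonal:
  assumes "M > 0"
  shows "(\<Sum>n<M. e (of_int (int n * j) / real M)) = (if int M dvd j then of_nat M else 0)"
proof -
  define z where "z = e (of_int j / real M)"
  have eq: "e (of_int (int n * j) / real M) = z ^ n" for n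
    by (simp add: z_def e_power)
  have z1: "z = 1 \<longleftrightarrow> int M dvd j"
  proof -
    have "z = 1 \<longleftrightarrow> of_int j / real M \<in> \<int>"
      by (simp add: z_def e_eq_1_iff)
    also have "\<dots> \<longleftrightarrow> int M dvd j"
      using assms of_int_div_of_int_in_Ints_iff[where ?'a = real, of j "int M"] by auto
    finally show ?thesis .
  qed
  have zM: "z ^ M = 1"
    using assms by (simp add: z_def e_power)
  show ?thesis
    unfolding eq using zM z1 by (auto simp: geometric_sum)
qed

lemma fourier_cmult: "fourier M (\<lambda>m. c * f m) r = c * fourier M f r"
  by (simp add: fourier_def sum_distrib_left mult_ac)

text \<open>
  Fourier inversion at a single point. As \<open>b\<close> takes the value \<open>1\<close> at \<open>\<plusminus>1\<close>, this is enough to evaluate the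
  product of the two constants \<open>C\<close>.
\<close>
lemma fourier_fourier_1:
  assumes "M > 0"
  shows "fourier M (fourier M f) 1 = of_nat M * f (int M - 1)"
proof -
  have "fourier M (fourier M f) 1
      = (\<Sum>m<M. f (int m) * (\<Sum>n<M. e (of_int (int n * (int m + 1)) / real M)))"
  proof -
    have "fourier M (fourier M f) 1
        = (\<Sum>n<M. \<Sum>m<M. f (int m) * e (of_int (int n * (int m + 1)) / real M))"
      unfolding fourier_def sum_distrib_right
    proof (intro sum.cong refl)
      fix n m
      have "of_int (int m * int n) / real M + of_int (int n * 1) / real M
          = of_int (int n * (int m + 1)) / real M"
        by (simp add: add_divide_distrib[symmetric] algebra_simps)
      thus "f (int m) * e (of_int (int m * int n) / real M) * e (of_int (int n * 1) / real M)
          = f (int m) * e (of_int (int n * (int m + 1)) / real M)"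
        by (metis e_add mult.assoc)
    qed
    also have "\<dots> = (\<Sum>m<M. \<Sum>n<M. f (int m) * e (of_int (int n * (int m + 1)) / real M))"
      by (rule sum.swap)
    finally show ?thesis by (simp only: sum_distrib_left)
  qed
  also have "\<dots> = (\<Sum>m<M. if m = M - 1 then f (int m) * of_nat M else 0)"
    unfolding sum_e_orthogonal[OF assms]
  proof (rule sum.cong)
    fix m assume "m \<in> {..<M}"
    hence "int M dvd int m + 1 \<longleftrightarrow> m = M - 1"
      using zdvd_imp_le[of "int M" "int m + 1"] assms by auto
    thus "f (int m) * (if int M dvd int m + 1 then of_nat M else 0)
        = (if m = M - 1 then f (int m) * of_nat M else 0)" by simp
  qed simp
  also have "\<dots> = of_nat M * f (int M - 1)"
    using assms by (simp add: of_nat_diff)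
  finally show ?thesis .
qed

lemma parseval:
  assumes "M > 0"
  shows "(\<Sum>r<M. norm (fourier M f (int r)) ^ 2) = real M * (\<Sum>m<M. norm (f (int m)) ^ 2)"
proof -
  have "complex_of_real (\<Sum>r<M. norm (fourier M f (int r)) ^ 2)
      = (\<Sum>r<M. fourier M f (int r) * cnj (fourier M f (int r)))"
    unfolding of_real_sum complex_norm_square ..
  also have "\<dots> = (\<Sum>r<M. \<Sum>m<M. \<Sum>n<M. f (int m) * cnj (f (int n))
                     * e (of_int (int r * (int m - int n)) / real M))"
    unfolding fourier_def cnj_sum sum_product
  proof (intro sum.cong refl)
    fix r m n
    have "of_int (int m * int r) / real M + - (of_int (int n * int r) / real M)
        = of_int (int r * (int m - int n)) / real M"
      by (simp add: diff_divide_distrib[symmetric] algebra_simps)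
    hence "e (of_int (int m * int r) / real M) * e (- (of_int (int n * int r) / real M))
        = e (of_int (int r * (int m - int n)) / real M)"
      by (metis e_add)
    thus "f (int m) * e (of_int (int m * int r) / real M)
           * cnj (f (int n) * e (of_int (int n * int r) / real M))
        = f (int m) * cnj (f (int n)) * e (of_int (int r * (int m - int n)) / real M)"
      by (simp add: cnj_e mult_ac)
  qed
  also have "\<dots> = (\<Sum>m<M. \<Sum>r<M. \<Sum>n<M. f (int m) * cnj (f (int n))
                     * e (of_int (int r * (int m - int n)) / real M))"
    by (rule sum.swap)
  also have "\<dots> = (\<Sum>m<M. \<Sum>n<M. \<Sum>r<M. f (int m) * cnj (f (int n))
                     * e (of_int (int r * (int m - int n)) / real M))"
    by (intro sum.cong refl sum.swap)
  also have "\<dots> = (\<Sum>m<M. \<Sum>n<M. if n = m then f (int m) * cnj (f (int m)) * of_nat M else 0)"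
    unfolding sum_distrib_left[symmetric] sum_e_orthogonal[OF assms]
  proof (intro sum.cong refl)
    fix m n assume "m \<in> {..<M}" "n \<in> {..<M}"
    hence "int M dvd int m - int n \<longleftrightarrow> n = m"
      using zdvd_imp_le[of "int M" "int m - int n"] zdvd_imp_le[of "int M" "int n - int m"]
      by (cases "n < m"; cases "m < n") (auto simp: dvd_diff_commute)
    thus "f (int m) * cnj (f (int n)) * (if int M dvd int m - int n then of_nat M else 0)
        = (if n = m then f (int m) * cnj (f (int m)) * of_nat M else 0)" by simp
  qed
  also have "\<dots> = complex_of_real (real M * (\<Sum>m<M. norm (f (int m)) ^ 2))"
    by (simp add: complex_norm_square[symmetric] sum_distrib_left mult_ac)
  finally show ?thesis by (simp only: of_real_eq_iff)
qed

lemma sum_periodic_shift: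
  fixes f :: "int \<Rightarrow> complex"
  assumes "\<And>x. f (x + int p) = f x"
  shows "(\<Sum>k<p. f (int k + a)) = (\<Sum>k<p. f (int k))"
proof -
  have step: "(\<Sum>k<p. f (int k + (a + 1))) = (\<Sum>k<p. f (int k + a))" for a
  proof -
    have "(\<Sum>k<p. f (int (Suc k) + a)) + f a = (\<Sum>k<Suc p. f (int k + a))"
      by (subst sum.lessThan_Suc_shift) (simp add: add_ac)
    also have "\<dots> = (\<Sum>k<p. f (int k + a)) + f (a + int p)"
      by (simp add: add_ac)
    finally show ?thesis by (simp add: assms algebra_simps)
  qed
  show ?thesis
  proof (induction a rule: int_induct[where k = 0])
    case (step1 i) thus ?case using step[of i] by simp
  next
    case (step2 i) thus ?case using step[of "i - 1"] by simp
  qed simp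
qed

section \<open>The functions b and their Fourier transforms\<close>

lemma sum_odd_only:
  fixes f :: "nat \<Rightarrow> complex"
  assumes "\<And>k. f (2 * k) = 0"
  shows "(\<Sum>m<2 * n. f m) = (\<Sum>k<n. f (2 * k + 1))"
  using assms by (induction n) auto

lemma two_T: "2 * T k = k * (k + 1)"
  by (simp add: T_def)

lemma T_add: "T (k + a) = T k + a * k + T a"
proof -
  have "2 * T (k + a) = 2 * (T k + a * k + T a)"
    unfolding distrib_left two_T by (simp add: algebra_simps)
  thus ?thesis by simp
qed

lemma real_T: "real_of_int (T k) = of_int k * (of_int k + 1) / 2"
proof -
  have "2 * real_of_int (T k) = of_int (k * (k + 1))"
    unfolding two_T[symmetric] by simp
  thus ?thesis by simp
qed

lemma b_odd: "b h u (2 * k + 1) = e (of_int (u * T k) / real h)"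
  by (simp add: b_def)

lemma b_even: "even m \<Longrightarrow> b h u m = 0"
  by (simp add: b_def)

lemma norm_b: "norm (b h u m) = (if odd m then 1 else 0)"
  by (simp add: b_def)

lemma b_minus: "b h u (- m) = b h u m"
proof (cases "odd m")
  case True
  then obtain k where k: "m = 2 * k + 1" by (auto elim: oddE)
  have "- m = 2 * (- k - 1) + 1" by (simp add: k)
  moreover have "T (- k - 1) = T k" by (simp add: T_def algebra_simps)
  ultimately show ?thesis by (simp only: k b_odd)
qed (simp add: b_even)

text \<open>
  Replacing \<open>k\<close> by \<open>k + h\<close> changes \<open>T k\<close> by \<open>h k + h (h + 1) / 2\<close>. Divided by \<open>h\<close> this is a half-integer
  because \<open>h\<close> is even, and it stays one after multiplication by the odd number \<open>u\<close>.
\<close>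
lemma b_antiperiodic:
  assumes "h > 0" "even h" "odd u"
  shows "b h u (m + 2 * int h) = - b h u m"
proof (cases "odd m")
  case True
  then obtain k where k: "m = 2 * k + 1" by (auto elim: oddE)
  obtain g where g: "h = 2 * g" using assms(2) by blast
  obtain w where w: "u = 2 * w + 1" using assms(3) by (auto elim: oddE)
  have m: "m + 2 * int h = 2 * (k + int h) + 1" by (simp add: k)
  have "e (of_int (u * T (k + int h)) / real h) = e (of_int (u * T k) / real h + 1 / 2)"
  proof (rule e_cong)
    have "2 * (of_int (u * T (k + int h)) / real h - (of_int (u * T k) / real h + 1 / 2))
        = of_int (2 * (u * k + u * int g + w))"
      using assms(1) by (simp add: T_add real_T g w field_simps)
    thus "of_int (u * T (k + int h)) / real h - (of_int (u * T k) / real h + 1 / 2)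
        = of_int (u * k + u * int g + w)" by simp
  qed
  thus ?thesis unfolding m unfolding k b_odd by (simp only: e_add e_half mult_minus_right mult_1_right)
qed (simp add: b_even)

lemma b_periodic:
  assumes "h > 0" "even h" "odd u"
  shows "b h u (m + 4 * int h) = b h u m"
  using b_antiperiodic[OF assms, of "m + 2 * int h"] b_antiperiodic[OF assms, of m]
  by (simp add: add.assoc)

text \<open>
  The constant \<open>C h u\<close> is by definition the value at frequency \<open>1\<close>. Completing the square reduces every
  other odd frequency to it, and antiperiodicity kills the even frequencies. The hypothesis
  \<open>v u \<equiv> -1\<close> is symmetric in \<open>u\<close> and \<open>v\<close>, so the roles of the two parameters can be exchanged.
\<close>
lemma fourier_b:
  assumes h: "h > 0" "even h" and uv: "2 * int h dvd v * u + 1"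
  shows "fourier (4 * h) (b h u) r = C h u * b h v r"
proof -
  have "even (v * u + 1)" using uv by (metis dvd_trans dvd_triv_left)
  hence u: "odd u" by simp
  have F: "fourier (4 * h) (b h u) r
      = (\<Sum>k<2 * h. b h u (2 * int k + 1) * e (of_int ((2 * int k + 1) * r) / of_nat (4 * h)))" for r
    using sum_odd_only[of "\<lambda>m. b h u (int m) * e (of_int (int m * r) / of_nat (4 * h))" "2 * h"]
    by (simp add: fourier_def b_even add.commute)
  show ?thesis
  proof (cases "odd r")
    case False
    then obtain j where j: "r = 2 * j" by blast
    define g where "g k = b h u (2 * int k + 1) * e (of_int ((2 * int k + 1) * r) / of_nat (4 * h))" for k
    have split: "(\<Sum>k<h + n. g k) = (\<Sum>k<h. g k) + (\<Sum>k<n. g (k + h))" for n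
      by (induction n) (simp_all add: add_ac)
    \<comment> \<open>The two halves of the range of summation cancel.\<close>
    have anti: "g (k + h) = - g k" for k
    proof -
      have 1: "2 * int (k + h) + 1 = (2 * int k + 1) + 2 * int h" by simp
      have 2: "e (of_int ((2 * int (k + h) + 1) * r) / of_nat (4 * h))
          = e (of_int ((2 * int k + 1) * r) / of_nat (4 * h))"
        by (rule e_cong[where n = j]) (use h in \<open>simp add: j field_simps\<close>)
      show ?thesis unfolding g_def 2 unfolding 1 b_antiperiodic[OF h u] by simp
    qed
    have "2 * h = h + h" by simp
    hence "fourier (4 * h) (b h u) r = (\<Sum>k<h + h. g k)"
      by (simp only: F g_def)
    also have "\<dots> = 0" by (simp only: split) (simp add: anti sum_negf)
    finally show ?thesis using False by (simp add: b_even)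
  next
    case True
    then obtain j where j: "r = 2 * j + 1" by (auto elim: oddE)
    obtain c where c: "v * u + 1 = 2 * int h * c" using uv by blast
    define G where "G k = b h u (2 * k + 1) * e (of_int (2 * k + 1) / of_nat (4 * h))" for k :: int
    have G_periodic: "G (k + int (2 * h)) = G k" for k
    proof -
      have 1: "2 * (k + int (2 * h)) + 1 = (2 * k + 1) + 4 * int h" by simp
      have 2: "e (of_int (2 * k + 1 + 4 * int h) / of_nat (4 * h)) = e (of_int (2 * k + 1) / of_nat (4 * h))"
        by (rule e_cong[where n = 1]) (use h in \<open>simp add: field_simps\<close>)
      show ?thesis unfolding G_def 1 2 b_periodic[OF h u] ..
    qed
    have C: "C h u = (\<Sum>k<2 * h. G (int k))"
      unfolding C_def F G_def by simp
    \<comment> \<open>Then \<open>u a \<equiv> j\<close> modulo \<open>2h\<close>, so that \<open>u T (k + a)\<close> contains the cross term \<open>k j\<close>.\<close>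
    define a where "a = - v * j"
    have shift: "b h u (2 * k + 1) * e (of_int ((2 * k + 1) * r) / of_nat (4 * h))
        = G (k + a) * b h v r" for k
    proof -
      have "G (k + a) * b h v r = e (of_int (u * T (k + a)) / real h
          + of_int (2 * (k + a) + 1) / real (4 * h) + of_int (v * T j) / real h)"
        unfolding G_def j b_odd e_add by simp
      also have "\<dots> = e (of_int (u * T k) / real h + of_int ((2 * k + 1) * r) / real (4 * h))"
      proof (rule e_cong)
        have uv': "real_of_int v * of_int u = 2 * real h * of_int c - 1"
          using arg_cong[OF c, of real_of_int] by simp
        have "(of_int (u * T (k + a)) / real h
          + of_int (2 * (k + a) + 1) / real (4 * h) + of_int (v * T j) / real h
          - (of_int (u * T k) / real h + of_int ((2 * k + 1) * r) / real (4 * h)))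
          = (of_int v * of_int u * (- 2 * of_int j * of_int k + of_int j * (of_int v * of_int j - 1))
             + (- of_int v * of_int j + of_int v * of_int j * (of_int j + 1)) - 2 * of_int j * of_int k - of_int j) / (2 * real h)"
          using h by (simp add: T_add real_T a_def j field_simps power2_eq_square)
        also have "\<dots> = of_int (c * (j * (v * j - 1) - 2 * j * k))"
          unfolding uv' using h by (simp add: field_simps)
        finally show "of_int (u * T (k + a)) / real h
          + of_int (2 * (k + a) + 1) / real (4 * h) + of_int (v * T j) / real h
          - (of_int (u * T k) / real h + of_int ((2 * k + 1) * r) / real (4 * h))
          = of_int (c * (j * (v * j - 1) - 2 * j * k))" .
      qed
      finally show ?thesis unfolding b_odd by (simp add: e_add)
    qed
    have "fourier (4 * h) (b h u) r = (\<Sum>k<2 * h. G (int k + a)) * b h v r"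
      unfolding F sum_distrib_right by (intro sum.cong refl shift)
    also have "(\<Sum>k<2 * h. G (int k + a)) = C h u"
      unfolding C by (rule sum_periodic_shift) (rule G_periodic)
    finally show ?thesis .
  qed
qed

lemma C_mult_C_dual:
  assumes h: "h > 0" "even h" and uv: "2 * int h dvd v * u + 1"
  shows "C h u * C h v = of_nat (4 * h)"
proof -
  have "even (v * u + 1)" using uv by (metis dvd_trans dvd_triv_left)
  hence u: "odd u" by simp
  have vu: "2 * int h dvd u * v + 1" using uv by (simp add: mult.commute)
  have b1: "b h u 1 = 1" using b_odd[of h u 0] by (simp add: T_def)
  have "of_nat (4 * h) * b h u (int (4 * h) - 1) = fourier (4 * h) (fourier (4 * h) (b h u)) 1"
    using h by (subst fourier_fourier_1) auto
  also have "fourier (4 * h) (b h u) = (\<lambda>r. C h u * b h v r)"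
    using fourier_b[OF h uv] by auto
  also have "fourier (4 * h) \<dots> 1 = C h u * (C h v * b h u 1)"
    using fourier_b[OF h vu] by (simp add: fourier_cmult)
  also have "b h u (int (4 * h) - 1) = b h u 1"
    using b_periodic[OF h u, of "- 1"] b_minus[of h u 1] by (simp add: add_ac)
  finally show ?thesis by (simp add: b1)
qed

text \<open>
  Both \<open>b h u\<close> and \<open>b h v\<close> have modulus one on the odd residues and vanish on the even ones, so Parseval's
  identity compares equal sums.
\<close>
lemma norm_C:
  assumes h: "h > 0" "even h" and uv: "2 * int h dvd v * u + 1"
  shows "norm (C h u) = sqrt (real (4 * h))"
proof -
  have S: "(\<Sum>m<4 * h. (norm (b h w (int m)))\<^sup>2) = 2 * real h" for w
  proof -
    have "(\<Sum>m<2 * (2 * h). complex_of_real ((norm (b h w (int m)))\<^sup>2)) = of_real (2 * real h)"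
      by (subst sum_odd_only) (simp_all add: norm_b)
    hence "complex_of_real (\<Sum>m<4 * h. (norm (b h w (int m)))\<^sup>2) = of_real (2 * real h)"
      by simp
    thus ?thesis by (simp only: of_real_eq_iff)
  qed
  have "norm (C h u) ^ 2 * (2 * real h) = (\<Sum>r<4 * h. norm (fourier (4 * h) (b h u) (int r)) ^ 2)"
    unfolding fourier_b[OF h uv] norm_mult power_mult_distrib sum_distrib_left[symmetric] S ..
  also have "\<dots> = real (4 * h) * (2 * real h)"
    using h by (subst parseval) (auto simp: S)
  finally have "norm (C h u) ^ 2 = real (4 * h)" using h by simp
  thus ?thesis by (metis norm_ge_zero real_sqrt_unique)
qed

text \<open>
  A period is even because \<open>b\<close> is supported on odd numbers. If \<open>2p\<close> is a period, the phase increment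
  \<open>u (p k + T p) / h\<close> is an integer for all \<open>k\<close>. As \<open>u\<close> is coprime to \<open>h\<close>, the cases \<open>k = 0, 1\<close> give
  \<open>h dvd T p\<close> and \<open>h dvd p\<close>, and together these force \<open>2h dvd p\<close> because \<open>h\<close> is even.
\<close>
lemma minimal_period_b:
  assumes h: "h > 0" "even h" and uv: "2 * int h dvd v * u + 1"
  shows "is_minimal_period (b h u) (4 * h)"
  unfolding is_minimal_period_def
proof (intro conjI allI impI)
  have u: "odd u" using uv by (metis dvd_trans dvd_triv_left even_add even_mult_iff odd_one)
  show "is_period (b h u) (4 * h)"
    using b_periodic[OF h u] h by (simp add: is_period_def)
  fix q assume "is_period (b h u) q"
  hence q: "q > 0" "\<And>m. b h u (m + int q) = b h u m"
    by (auto simp: is_period_def)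
  have "even q"
  proof (rule ccontr)
    assume "odd q"
    with q(2)[of 1] norm_b[of h u 1] norm_b[of h u "1 + int q"] show False by simp
  qed
  then obtain p where p: "q = 2 * p" by blast
  have key: "int h dvd u * (int p * k + T (int p))" for k
  proof -
    have "b h u (2 * (k + int p) + 1) = b h u (2 * k + 1)"
      using q(2)[of "2 * k + 1"] by (simp add: p algebra_simps)
    hence "e (of_int (u * T (k + int p)) / real h) / e (of_int (u * T k) / real h) = 1"
      unfolding b_odd by (metis divide_self norm_e norm_zero zero_neq_one)
    also have "e (of_int (u * T (k + int p)) / real h)
       = e (of_int (u * (int p * k + T (int p))) / real h) * e (of_int (u * T k) / real h)"
      unfolding e_add[symmetric] by (simp add: T_add algebra_simps add_divide_distrib)
    finally have "e (of_int (u * (int p * k + T (int p))) / real h) = 1"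
      by (metis nonzero_mult_div_cancel_right norm_e norm_zero zero_neq_one)
    hence "real_of_int (u * (int p * k + T (int p))) / of_int (int h) \<in> \<int>"
      by (simp add: e_eq_1_iff)
    thus ?thesis using h by (subst (asm) of_int_div_of_int_in_Ints_iff) auto
  qed
  have cop: "coprime (int h) u"
  proof (rule coprimeI)
    fix d assume d: "d dvd int h" "d dvd u"
    have "d dvd 2 * int h" using d(1) by (rule dvd_mult)
    hence "d dvd v * u + 1" using uv by (rule dvd_trans)
    moreover have "d dvd v * u" using d(2) by (rule dvd_mult)
    ultimately have "d dvd (v * u + 1) - v * u" by (rule dvd_diff)
    thus "is_unit d" by simp
  qed
  have T: "int h dvd T (int p)"
    using key[of 0] cop by (simp add: coprime_dvd_mult_right_iff)
  have "int h dvd int p + T (int p)"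
    using key[of 1] cop by (simp add: coprime_dvd_mult_right_iff)
  with T have "int h dvd int p" using dvd_add_left_iff[of "int h" "T (int p)" "int p"] by blast
  then obtain t where t: "int p = int h * t" by blast
  obtain s where s: "T (int p) = int h * s" using T by blast
  have "int h * (2 * s) = int h * (t * (int h * t + 1))"
    using two_T[of "int p"] unfolding s unfolding t by (simp add: algebra_simps)
  hence "2 * s = t * (int h * t + 1)" using h by simp
  hence "even (t * (int h * t + 1))" by (metis dvd_triv_left)
  hence "even t" using h(2) by auto
  then obtain t' where "t = 2 * t'" by blast
  hence "int q = int (4 * h) * t'" by (simp add: p t)
  hence "int (4 * h) dvd int q" by simp
  hence "4 * h dvd q" by (simp only: int_dvd_int_iff)
  thus "4 * h \<le> q" using q(1) by (rule dvd_imp_le)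
qed

lemma dual_cong:
  assumes "h > 0" and "\<alpha> \<in> Units (residue_ring (2 * int h))"
  shows "2 * int h dvd dual h \<alpha> * \<alpha> + 1"
proof -
  interpret residues "2 * int h" "residue_ring (2 * int h)"
    by unfold_locales (use assms in auto)
  let ?R = "residue_ring (2 * int h)"
  let ?i = "inv\<^bsub>?R\<^esub> \<alpha>"
  have "\<alpha> \<otimes>\<^bsub>?R\<^esub> ?i = \<one>\<^bsub>?R\<^esub>"
    using assms(2) by (rule Units_r_inv)
  hence "(\<alpha> * ?i) mod (2 * int h) = 1"
    by (simp add: res_mult_eq res_one_eq)
  hence "(\<alpha> * ?i) mod (2 * int h) = 1 mod (2 * int h)"
    using assms(1) by simp
  hence "2 * int h dvd \<alpha> * ?i - 1"
    by (simp only: mod_eq_dvd_iff)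
  moreover have "dual h \<alpha> = (- ?i) mod (2 * int h)"
    unfolding dual_def by (rule res_neg_eq)
  hence "dual h \<alpha> mod (2 * int h) = (- ?i) mod (2 * int h)"
    by simp
  hence "2 * int h dvd dual h \<alpha> - (- ?i)"
    by (simp only: mod_eq_dvd_iff)
  hence "2 * int h dvd dual h \<alpha> + ?i" by simp
  hence "2 * int h dvd (dual h \<alpha> + ?i) * \<alpha>" by simp
  ultimately have "2 * int h dvd (dual h \<alpha> + ?i) * \<alpha> - (\<alpha> * ?i - 1)" by (rule dvd_diff[rotated])
  thus ?thesis by (simp add: algebra_simps)
qed

section \<open>Continuation of the Hurwitz zeta function\<close>

lemma summable_shifted_powr:
  fixes a q :: real
  assumes "a > 0" "q > 1"
  shows "summable (\<lambda>n. (real n + a) powr (- q))"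
proof (rule summable_comparison_test_ev)
  show "\<forall>\<^sub>F n in sequentially. norm ((real n + a) powr (- q)) \<le> real n powr (- q)"
    using eventually_gt_at_top[of 0]
    by eventually_elim (use assms in \<open>auto intro!: powr_mono2'\<close>)
  show "summable (\<lambda>n. real n powr (- q))"
    using assms by (simp add: summable_real_powr_iff)
qed

text \<open>
  The form in which Weierstrass' theorem is applied, both to the Dirichlet series itself (\<open>K = 0\<close>) and
  to the series of Taylor remainders, which converges in a larger half-plane.
\<close>
lemma holomorphic_suminf_shifted_powr:
  fixes G :: "nat \<Rightarrow> complex \<Rightarrow> complex" and a K :: real
  assumes a: "a > 0"
    and hol: "\<And>n. G n holomorphic_on {s. Re s > 1 - K}"
    and bound: "\<And>n s. Re s > 1 - K \<Longrightarrow> norm (G n s) \<le> c s * (real n + a) powr (- (Re s + K))"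
    and c: "continuous_on {s. Re s > 1 - K} c"
  shows "(\<lambda>s. \<Sum>n. G n s) holomorphic_on {s. Re s > 1 - K}"
    and "\<And>s. Re s > 1 - K \<Longrightarrow> summable (\<lambda>n. G n s)"
proof -
  let ?H = "{s. Re s > 1 - K}"
  show "summable (\<lambda>n. G n s)" if "Re s > 1 - K" for s
    by (rule summable_comparison_test'[where g = "\<lambda>n. c s * (real n + a) powr (- (Re s + K))" and N = 0])
       (use bound[OF that] summable_mult[OF summable_shifted_powr[of a "Re s + K"], of "c s"] that a in auto)
  show "(\<lambda>s. \<Sum>n. G n s) holomorphic_on ?H"
  proof (rule holomorphic_uniform_sequence[where f = "\<lambda>N s. \<Sum>n<N. G n s"])
    show "open ?H" by (rule open_halfspace_Re_gt)
    show "(\<lambda>s. \<Sum>n<N. G n s) holomorphic_on ?H" for N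
      by (intro holomorphic_intros hol)
    fix x assume x: "x \<in> ?H"
    define d where "d = (Re x - (1 - K)) / 2"
    have d: "d > 0" using x by (simp add: d_def)
    have Re: "Re x - d \<le> Re s" "Re s \<le> Re x + d" if "s \<in> cball x d" for s
    proof -
      have "\<bar>Re (x - s)\<bar> \<le> d"
        using that abs_Re_le_cmod[of "x - s"] by (simp add: dist_norm)
      thus "Re x - d \<le> Re s" "Re s \<le> Re x + d" by auto
    qed
    have sub: "cball x d \<subseteq> ?H"
    proof
      fix s assume "s \<in> cball x d"
      hence "Re x - d \<le> Re s" by (rule Re(1))
      thus "s \<in> ?H" using x by (simp add: d_def field_simps)
    qed
    have "bounded (c ` cball x d)"
      by (intro compact_imp_bounded compact_continuous_image continuous_on_subset[OF c sub]) auto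
    then obtain B where B: "B > 0" "\<And>s. s \<in> cball x d \<Longrightarrow> \<bar>c s\<bar> \<le> B"
      unfolding bounded_pos by auto
    \<comment> \<open>On the disc the exponent lies between \<open>q\<close> and \<open>p\<close>. Two powers are needed for a uniform bound,
      since the base \<open>n + a\<close> is below \<open>1\<close> when \<open>n = 0\<close> and \<open>a < 1\<close>.\<close>
    define q p where "q = Re x - d + K" and "p = Re x + d + K"
    have q: "q > 1" using x by (simp add: q_def d_def field_simps)
    have p: "p > 1" using d q by (simp add: p_def q_def)
    have "uniform_limit (cball x d) (\<lambda>N s. \<Sum>n<N. G n s) (\<lambda>s. \<Sum>n. G n s) sequentially"
    proof (rule Weierstrass_m_test)
      show "summable (\<lambda>n. B * ((real n + a) powr (- q) + (real n + a) powr (- p)))"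
        by (intro summable_mult summable_add summable_shifted_powr a q p)
      fix n s assume s: "s \<in> cball x d"
      have "(real n + a) powr (- (Re s + K)) \<le> (real n + a) powr (- q) + (real n + a) powr (- p)"
      proof (cases "real n + a \<ge> 1")
        case True
        hence "(real n + a) powr (- (Re s + K)) \<le> (real n + a) powr (- q)"
          using Re[OF s] by (intro powr_mono) (auto simp: q_def)
        thus ?thesis by (simp add: add_increasing2)
      next
        case False
        hence "(real n + a) powr (- (Re s + K)) \<le> (real n + a) powr (- p)"
          using Re[OF s] a by (intro powr_mono') (auto simp: p_def)
        thus ?thesis by (simp add: add_increasing)
      qed
      moreover have "c s \<le> B" using B(2)[OF s] by simp
      ultimately have "c s * (real n + a) powr (- (Re s + K))
          \<le> B * ((real n + a) powr (- q) + (real n + a) powr (- p))"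
        using B(1) by (intro mult_mono) auto
      thus "norm (G n s) \<le> B * ((real n + a) powr (- q) + (real n + a) powr (- p))"
        using bound[of s n] s sub by fastforce
    qed
    thus "\<exists>d. 0 < d \<and> cball x d \<subseteq> ?H \<and>
        uniform_limit (cball x d) (\<lambda>N s. \<Sum>n<N. G n s) (\<lambda>s. \<Sum>n. G n s) sequentially"
      using d sub by blast
  qed
qed

text \<open>
  The falling factorial, so that \<open>falling k w / fact k\<close> is the binomial coefficient in the expansion of
  \<open>(x + 1) powr w\<close>.
\<close>
definition falling :: "nat \<Rightarrow> complex \<Rightarrow> complex" where
  "falling k w = (\<Prod>j<k. w - of_nat j)"

lemma falling_0 [simp]: "falling 0 w = 1"
  and falling_Suc: "falling (Suc k) w = falling k w * (w - of_nat k)"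
  by (simp_all add: falling_def)

lemma holomorphic_falling [holomorphic_intros]:
  "f holomorphic_on A \<Longrightarrow> (\<lambda>s. falling k (f s)) holomorphic_on A"
  unfolding falling_def by (intro holomorphic_intros)

definition powr_remainder :: "nat \<Rightarrow> real \<Rightarrow> complex \<Rightarrow> complex" where
  "powr_remainder K x w = of_real (x + 1) powr w
     - (\<Sum>k\<le>K. falling k w / fact k * of_real x powr (w - of_nat k))"

text \<open>
  Taylor's theorem on the segment from \<open>x\<close> to \<open>x + 1\<close>. The derivative of order \<open>K + 1\<close> decreases along the
  segment, so its size at \<open>x\<close> bounds the remainder. The gain of \<open>K + 1\<close> powers of \<open>x\<close> is what moves the
  abscissa of convergence to the left.
\<close>
lemma norm_powr_remainder_le:
  assumes "x > 0" "Re w \<le> real K + 1"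
  shows "norm (powr_remainder K x w) \<le> norm (falling (Suc K) w) / fact K * x powr (Re w - real K - 1)"
proof -
  define S where "S = closed_segment (complex_of_real x) (of_real (x + 1))"
  define f where "f i z = falling i w * z powr (w - of_nat i)" for i z
  have S: "\<exists>y\<ge>x. z = of_real y" if z: "z \<in> S" for z
  proof -
    from z obtain t where t: "0 \<le> t" "t \<le> 1" "z = (1 - t) *\<^sub>R complex_of_real x + t *\<^sub>R of_real (x + 1)"
      by (auto simp: S_def closed_segment_def)
    hence "z = of_real (x + t)" by (simp add: scaleR_conv_of_real algebra_simps)
    thus ?thesis using t(1) by (intro exI[of _ "x + t"]) auto
  qed
  have "norm (f 0 (of_real (x + 1)) - (\<Sum>i\<le>K. f i (of_real x) * (of_real (x + 1) - of_real x) ^ i / fact i))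
     \<le> (norm (falling (Suc K) w) * x powr (Re w - real K - 1)) * norm (of_real (x + 1) - complex_of_real x) ^ Suc K / fact K"
  proof (rule complex_Taylor[of S])
    show "convex S" "complex_of_real x \<in> S" "of_real (x + 1) \<in> S" by (simp_all add: S_def)
    fix z assume z: "z \<in> S"
    then obtain y where y: "y \<ge> x" "z = of_real y" using S by blast
    show "(f i has_field_derivative f (Suc i) z) (at z within S)" for i
    proof -
      have "z \<notin> \<real>\<^sub>\<le>\<^sub>0" using y assms by (auto simp: complex_nonpos_Reals_iff)
      hence "((\<lambda>z. z powr (w - of_nat i)) has_field_derivative
            (w - of_nat i) * z powr (w - of_nat i - 1)) (at z within S)"
        by (intro has_field_derivative_at_within[OF has_field_derivative_powr])
      hence "((\<lambda>z. falling i w * z powr (w - of_nat i)) has_field_derivative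
            falling i w * ((w - of_nat i) * z powr (w - of_nat i - 1))) (at z within S)"
        by (rule DERIV_cmult)
      thus ?thesis by (simp add: f_def[abs_def] falling_Suc algebra_simps)
    qed
    have "y powr (Re w - real K - 1) \<le> x powr (Re w - real K - 1)"
      using y assms by (intro powr_mono2') auto
    thus "norm (f (Suc K) z) \<le> norm (falling (Suc K) w) * x powr (Re w - real K - 1)"
      using y assms by (simp add: f_def norm_mult norm_powr_real_powr mult_left_mono algebra_simps)
  qed
  thus ?thesis by (simp add: f_def powr_remainder_def)
qed

text \<open>
  Sum the Taylor expansion of \<open>(x + 1) powr (1 - s) - x powr (1 - s)\<close> over \<open>x = a, a + 1, \<dots>\<close>. The
  left-hand side telescopes to \<open>- a powr (1 - s)\<close>, and the term of order \<open>i + 1\<close> contributes a multiple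
  of \<open>Z (s + i)\<close>. The last factor of \<open>falling (Suc i) (1 - s)\<close> is \<open>- (s + i - 1)\<close>, exactly the factor
  that removes the pole of \<open>Z (s + i)\<close>; hence the recurrence can be written for \<open>(s - 1) Z s\<close>.
\<close>
lemma hurwitz_continuation_recurrence:
  fixes a :: real and s :: complex and K :: nat
  defines "Z \<equiv> \<lambda>s. \<Sum>n. of_real (real n + a) powr (- s)"
  assumes a: "a > 0" and s: "Re s > 1"
    and summable: "\<And>s. Re s > 1 \<Longrightarrow> summable (\<lambda>n. complex_of_real (real n + a) powr (- s))"
    and summable_R: "summable (\<lambda>n. powr_remainder (Suc K) (real n + a) (1 - s))"
  shows "(s - 1) * Z s = of_real a powr (1 - s)
     - (\<Sum>i=1..K. falling i (1 - s) / fact (Suc i) * ((s + of_nat i - 1) * Z (s + of_nat i)))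
     + (\<Sum>n. powr_remainder (Suc K) (real n + a) (1 - s))"
proof -
  let ?x = "\<lambda>n. real n + a"
  let ?R = "\<lambda>n. powr_remainder (Suc K) (?x n) (1 - s)"
  have "(\<lambda>n. of_real (?x n) powr (1 - s)) \<longlonglongrightarrow> 0"
  proof (rule tendsto_norm_zero_cancel)
    have "(\<lambda>n. ?x n powr (1 - Re s)) \<longlonglongrightarrow> 0"
    proof (rule tendsto_neg_powr)
      show "filterlim ?x at_top sequentially" by real_asymp
    qed (use s in auto)
    thus "(\<lambda>n. norm (complex_of_real (?x n) powr (1 - s))) \<longlonglongrightarrow> 0"
      using a by (simp add: norm_powr_real_powr)
  qed
  hence "(\<lambda>n. of_real (?x (Suc n)) powr (1 - s) - of_real (?x n) powr (1 - s))
      sums (0 - of_real (?x 0) powr (1 - s))"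
    by (rule telescope_sums)
  moreover have "of_real (?x (Suc n)) powr (1 - s) - of_real (?x n) powr (1 - s)
      = (\<Sum>i\<le>K. falling (Suc i) (1 - s) / fact (Suc i) * of_real (?x n) powr (- (s + of_nat i))) + ?R n" for n
    by (simp add: powr_remainder_def sum.atMost_Suc_shift del: sum.atMost_Suc)
       (simp add: algebra_simps)
  moreover have "(\<lambda>n. (\<Sum>i\<le>K. falling (Suc i) (1 - s) / fact (Suc i) * of_real (?x n) powr (- (s + of_nat i))) + ?R n)
      sums ((\<Sum>i\<le>K. falling (Suc i) (1 - s) / fact (Suc i) * Z (s + of_nat i)) + (\<Sum>n. ?R n))"
    unfolding Z_def using s
    by (intro sums_add sums_sum sums_mult summable_sums summable summable_R) auto
  ultimately have "- (of_real a powr (1 - s))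
      = (\<Sum>i\<le>K. falling (Suc i) (1 - s) / fact (Suc i) * Z (s + of_nat i)) + (\<Sum>n. ?R n)"
    by (metis (no_types, lifting) add_0 diff_0 of_nat_0 sums_cong sums_unique2)
  also have "(\<Sum>i\<le>K. falling (Suc i) (1 - s) / fact (Suc i) * Z (s + of_nat i))
      = (\<Sum>i\<le>K. - (falling i (1 - s) / fact (Suc i) * ((s + of_nat i - 1) * Z (s + of_nat i))))"
  proof (intro sum.cong refl)
    fix i
    have "1 - s - of_nat i = - (s + of_nat i - 1)" by simp
    thus "falling (Suc i) (1 - s) / fact (Suc i) * Z (s + of_nat i)
        = - (falling i (1 - s) / fact (Suc i) * ((s + of_nat i - 1) * Z (s + of_nat i)))"
      by (simp only: falling_Suc mult_minus_right mult_minus_left minus_divide_left times_divide_eq_left times_divide_eq_right mult_ac)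
  qed
  also have "\<dots> = - (s - 1) * Z s
      - (\<Sum>i=1..K. falling i (1 - s) / fact (Suc i) * ((s + of_nat i - 1) * Z (s + of_nat i)))"
  proof -
    have "(\<Sum>i\<le>K. - t i) = - t 0 - (\<Sum>i=1..K. t i)" for t :: "nat \<Rightarrow> complex"
      by (subst sum.atMost_shift) (simp add: sum_negf sum.atLeast1_atMost_eq)
    from this[of "\<lambda>i. falling i (1 - s) / fact (Suc i) * ((s + of_nat i - 1) * Z (s + of_nat i))"]
    show ?thesis by (simp only: of_nat_0 falling_0 add_0_right mult_minus_left) simp
  qed
  finally show ?thesis by (simp add: algebra_simps)
qed

text \<open>
  The right-hand side of the recurrence only evaluates \<open>(s - 1) Z s\<close> at points further to the right, so
  each application extends the continuation by a strip of width one.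
\<close>
lemma hurwitz_halfplane:
  fixes a :: real
  assumes a: "a > 0"
  shows "\<exists>F. F holomorphic_on {s. Re s > 1 - real N} \<and>
           (\<forall>s. Re s > 1 \<longrightarrow> F s = (s - 1) * (\<Sum>n. of_real (real n + a) powr (- s)))"
proof -
  define Z where "Z s = (\<Sum>n. complex_of_real (real n + a) powr (- s))" for s
  have Z: "Z holomorphic_on {s. Re s > 1 - 0}"
    and summable_Z: "\<And>s. Re s > 1 - 0 \<Longrightarrow> summable (\<lambda>n. complex_of_real (real n + a) powr (- s))"
  proof -
    have 1: "(\<lambda>s. complex_of_real (real n + a) powr (- s)) holomorphic_on {s. Re s > 1 - 0}" for n
      by (intro holomorphic_intros)
    have 2: "norm (complex_of_real (real n + a) powr (- s)) \<le> 1 * (real n + a) powr (- (Re s + 0))" for n s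
      using a by (simp add: norm_powr_real_powr)
    note H = holomorphic_suminf_shifted_powr[of a "\<lambda>n s. complex_of_real (real n + a) powr (- s)" 0 "\<lambda>_. 1",
        OF a 1 2 continuous_on_const]
    show "Z holomorphic_on {s. Re s > 1 - 0}" unfolding Z_def[abs_def] by (rule H(1))
    show "\<And>s. Re s > 1 - 0 \<Longrightarrow> summable (\<lambda>n. complex_of_real (real n + a) powr (- s))" by (rule H(2))
  qed
  show ?thesis unfolding Z_def[symmetric]
  proof (induction N)
    case 0
    show ?case using Z by (intro exI[of _ "\<lambda>s. (s - 1) * Z s"]) (auto intro!: holomorphic_intros)
  next
    case (Suc N)
    then obtain F where F: "F holomorphic_on {s. Re s > 1 - real N}"
      "\<And>s. Re s > 1 \<Longrightarrow> F s = (s - 1) * Z s" by blast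
    let ?H = "{s. Re s > 1 - real (Suc N)}"
    let ?R = "\<lambda>n s. powr_remainder (Suc N) (real n + a) (1 - s)"
    define G where "G s = of_real a powr (1 - s)
       - (\<Sum>i=1..N. falling i (1 - s) / fact (Suc i) * F (s + of_nat i)) + (\<Sum>n. ?R n s)" for s
    have bound: "norm (?R n s) \<le> norm (falling (Suc (Suc N)) (1 - s)) / fact (Suc N)
        * (real n + a) powr (- (Re s + real (Suc N)))" if "Re s > 1 - real (Suc N)" for n s
    proof -
      have "Re (1 - s) - real (Suc N) - 1 = - (Re s + real (Suc N))" by simp
      moreover have "norm (?R n s) \<le> norm (falling (Suc (Suc N)) (1 - s)) / fact (Suc N)
          * (real n + a) powr (Re (1 - s) - real (Suc N) - 1)"
        by (rule norm_powr_remainder_le) (use a that in auto)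
      ultimately show ?thesis by (simp only:)
    qed
    have hol_R: "?R n holomorphic_on ?H" for n
      unfolding powr_remainder_def by (intro holomorphic_intros) auto
    have cont: "continuous_on ?H (\<lambda>s. norm (falling (Suc (Suc N)) (1 - s)) / fact (Suc N))"
      by (intro continuous_intros holomorphic_on_imp_continuous_on holomorphic_intros) auto
    note R = holomorphic_suminf_shifted_powr[of a ?R "real (Suc N)", OF a hol_R bound cont]
    \<comment> \<open>Here \<open>i \<ge> 1\<close> is used: the shift maps the new half-plane into the old one.\<close>
    have "(\<lambda>s. F (s + of_nat i)) holomorphic_on ?H" if "i \<in> {1..N}" for i
      by (rule holomorphic_on_compose_gen[OF _ F(1), unfolded o_def])
         (use that in \<open>auto intro!: holomorphic_intros\<close>)
    hence "G holomorphic_on ?H"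
      unfolding G_def[abs_def] using a by (intro holomorphic_intros R(1)) auto
    moreover have "G s = (s - 1) * Z s" if s: "Re s > 1" for s
    proof -
      have "G s = of_real a powr (1 - s)
       - (\<Sum>i=1..N. falling i (1 - s) / fact (Suc i) * ((s + of_nat i - 1) * Z (s + of_nat i))) + (\<Sum>n. ?R n s)"
        unfolding G_def using s by (subst F(2)) (auto simp: add_increasing2)
      also have "\<dots> = (s - 1) * Z s"
        unfolding Z_def using a s summable_Z
        by (intro hurwitz_continuation_recurrence[symmetric] R(2)) auto
      finally show ?thesis .
    qed
    ultimately show ?case by blast
  qed
qed

text \<open>
  The continuations to the half-planes agree on overlaps by the identity theorem and glue together.
\<close>
lemma hurwitz_entire:
  fixes a :: real
  assumes a: "a > 0"
  shows "\<exists>F. F holomorphic_on UNIV \<and>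
           (\<forall>s. Re s > 1 \<longrightarrow> F s = (s - 1) * (\<Sum>n. of_real (real n + a) powr (- s)))"
proof -
  let ?Z = "\<lambda>s. (s - 1) * (\<Sum>n. complex_of_real (real n + a) powr (- s))"
  let ?H = "\<lambda>N::nat. {s. Re s > 1 - real N}"
  have "\<forall>N. \<exists>F. F holomorphic_on ?H N \<and> (\<forall>s. Re s > 1 \<longrightarrow> F s = ?Z s)"
    using hurwitz_halfplane[OF a] by blast
  then obtain F where F: "\<And>N. F N holomorphic_on ?H N" "\<And>N s. Re s > 1 \<Longrightarrow> F N s = ?Z s"
    by metis
  have mono: "F N s = F N' s" if "N \<le> N'" "s \<in> ?H N" for N N' s
  proof (rule analytic_continuation_open[of "{s. Re s > 1}" "?H N" "F N" "F N'"])
    show "connected (?H N)" by (intro convex_connected convex_halfspace_Re_gt)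
    show "{s. Re s > 1} \<noteq> {}" by (auto intro!: exI[of _ 2])
    show "F N' holomorphic_on ?H N"
      by (rule holomorphic_on_subset[OF F(1)]) (use that(1) in auto)
    show "F N z = F N' z" if "z \<in> {s. Re s > 1}" for z
      using that F(2) by simp
  qed (use that F(1) in \<open>auto simp: open_halfspace_Re_gt\<close>)
  \<comment> \<open>Any index whose half-plane contains \<open>s\<close> would do.\<close>
  define G where "G s = F (nat \<lceil>2 - Re s\<rceil>) s" for s
  have G: "G s = F N s" if "s \<in> ?H N" for N s
  proof -
    have "s \<in> ?H (nat \<lceil>2 - Re s\<rceil>)" by (auto, linarith)
    thus ?thesis unfolding G_def using that mono by (metis linorder_le_cases)
  qed
  have "G holomorphic_on (\<Union>N. ?H N)"
    by (rule holomorphic_on_UN_open)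
       (auto intro: holomorphic_transform[OF F(1)] simp: G open_halfspace_Re_gt)
  moreover have "(\<Union>N. ?H N) = UNIV"
  proof -
    have "\<exists>N. Re s > 1 - real N" for s
      using reals_Archimedean2[of "1 - Re s"] by (auto simp: algebra_simps)
    thus ?thesis by auto
  qed
  moreover have "G s = ?Z s" if "Re s > 1" for s
    using G[of s 0] F(2)[of s 0] that by simp
  ultimately show ?thesis by auto
qed

text \<open>
  Existence comes from the continuation above and uniqueness from the identity theorem on the connected
  set \<open>- {1}\<close>, so the definite description is well-defined.
\<close>
lemma hurwitz_zeta:
  fixes a :: real
  assumes a: "a > 0"
  shows holomorphic_hurwitz_zeta: "(\<lambda>s. hurwitz_zeta s a) holomorphic_on (- {1})"
    and hurwitz_zeta_sums: "\<And>s. Re s > 1 \<Longrightarrow>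
          (\<lambda>n. of_real (real n + a) powr (- s)) sums hurwitz_zeta s a"
proof -
  define P where "P f \<longleftrightarrow> f holomorphic_on (- {1}) \<and> f 1 = 0 \<and>
        (\<forall>w. Re w > 1 \<longrightarrow> (\<lambda>n. of_real (real n + a) powr (- w)) sums f w)" for f :: "complex \<Rightarrow> complex"
  obtain F where F: "F holomorphic_on UNIV"
    "\<And>s. Re s > 1 \<Longrightarrow> F s = (s - 1) * (\<Sum>n. of_real (real n + a) powr (- s))"
    using hurwitz_entire[OF a] by blast
  define f where "f s = (if s = 1 then 0 else F s / (s - 1))" for s
  have "P f" unfolding P_def
  proof (intro conjI allI impI)
    have "(\<lambda>s. F s / (s - 1)) holomorphic_on (- {1})"
      by (intro holomorphic_intros holomorphic_on_subset[OF F(1)]) auto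
    thus "f holomorphic_on (- {1})"
      by (rule holomorphic_transform) (auto simp: f_def)
    show "f 1 = 0" by (simp add: f_def)
    fix w assume w: "Re w > 1"
    have "summable (\<lambda>n. complex_of_real (real n + a) powr (- w))"
      by (rule summable_norm_cancel)
         (use a w summable_shifted_powr[of a "Re w"] in \<open>simp add: norm_powr_real_powr\<close>)
    moreover have "f w = (\<Sum>n. of_real (real n + a) powr (- w))"
      using w F(2)[of w] by (auto simp: f_def)
    ultimately show "(\<lambda>n. of_real (real n + a) powr (- w)) sums f w"
      by (simp add: summable_sums)
  qed
  moreover have "g = f" if "P g" for g
  proof
    fix s
    show "g s = f s"
    proof (cases "s = 1")
      case False
      show ?thesis
      proof (rule analytic_continuation_open[of "{s. Re s > 1}" "- {1}" g f])
        show "connected (- {1::complex})"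
          by (simp add: connected_punctured_universe)
        show "{s. Re s > 1} \<noteq> {}" by (auto intro!: exI[of _ 2])
        show "g z = f z" if "z \<in> {s. Re s > 1}" for z
          using that \<open>P f\<close> \<open>P g\<close> sums_unique2 unfolding P_def by blast
      qed (use False \<open>P f\<close> \<open>P g\<close> in \<open>auto simp: P_def open_halfspace_Re_gt\<close>)
    qed (use \<open>P f\<close> \<open>P g\<close> in \<open>auto simp: P_def\<close>)
  qed
  ultimately have "P (THE f. P f)" by (rule theI)
  moreover have "hurwitz_zeta s a = (THE f. P f) s" for s
    by (simp add: hurwitz_zeta_def P_def)
  ultimately have "P (\<lambda>s. hurwitz_zeta s a)" by simp
  thus "(\<lambda>s. hurwitz_zeta s a) holomorphic_on (- {1})"
    and "\<And>s. Re s > 1 \<Longrightarrow> (\<lambda>n. of_real (real n + a) powr (- s)) sums hurwitz_zeta s a"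
    by (auto simp: P_def)
qed

section \<open>Series with Gaussian decay\<close>

lemma summable_on_int_exp_abs: "(\<lambda>n::int. exp (- \<bar>real_of_int n\<bar>)) summable_on UNIV"
proof -
  let ?f = "\<lambda>n::int. exp (- \<bar>real_of_int n\<bar>)"
  have "summable (\<lambda>n. exp (- 1) ^ n :: real)"
    by (rule summable_geometric) simp
  hence S: "(\<lambda>n::nat. exp (- real n)) summable_on UNIV"
    by (intro summable_nonneg_imp_summable_on) (simp_all add: exp_of_nat_mult[symmetric])
  have "?f summable_on range int"
    using S by (subst summable_on_reindex) (auto simp: o_def)
  moreover have "?f summable_on range (\<lambda>n. - int n)"
    using S by (subst summable_on_reindex) (auto simp: o_def inj_on_def)
  ultimately have "?f summable_on range int \<union> range (\<lambda>n. - int n)"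
    by (rule summable_on_union)
  moreover have "range int \<union> range (\<lambda>n. - int n) = UNIV"
  proof -
    have "n \<in> range int \<union> range (\<lambda>n. - int n)" for n
      by (cases n rule: int_cases2) auto
    thus ?thesis by (intro equalityI subset_UNIV subsetI)
  qed
  ultimately show ?thesis by simp
qed

text \<open>
  Completing the square bounds the exponent by \<open>K - \<bar>n\<bar>\<close>, which leaves a geometric series.
\<close>
lemma summable_on_int_gaussian:
  fixes a d :: real
  assumes "a > 0"
  shows "(\<lambda>n::int. exp (- a * of_int n ^ 2 + d * \<bar>of_int n\<bar>)) summable_on UNIV"
proof -
  define K where "K = (d + 1) ^ 2 / (4 * a)"
  have "- a * x ^ 2 + d * x \<le> K - x" for x :: real
  proof -
    have "0 \<le> a * (x - (d + 1) / (2 * a)) ^ 2" using assms by simp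
    also have "\<dots> = a * x ^ 2 - (d + 1) * x + K"
      using assms by (simp add: K_def field_simps power2_eq_square)
    finally show ?thesis by (simp add: algebra_simps)
  qed
  from this[of "\<bar>of_int n\<bar>" for n :: int]
  have "exp (- a * of_int n ^ 2 + d * \<bar>of_int n\<bar>) \<le> exp K * exp (- \<bar>of_int n\<bar>)" for n :: int
    by (simp add: exp_add[symmetric])
  hence le: "norm (exp (- a * of_int n ^ 2 + d * \<bar>of_int n\<bar>)) \<le> exp K * exp (- \<bar>of_int n\<bar>)" for n :: int
    by simp
  have "(\<lambda>n::int. exp K * exp (- \<bar>of_int n\<bar>)) summable_on UNIV"
    by (intro summable_on_cmult_right summable_on_int_exp_abs)
  thus ?thesis
    by (intro abs_summable_summable[OF Infinite_Sum.abs_summable_on_comparison_test'[OF _ le]])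
qed

lemma filterlim_symmetric_intervals:
  "filterlim (\<lambda>N. {- int N..int N}) (finite_subsets_at_top UNIV) sequentially"
proof (rule filterlim_atLeastAtMost_at_bot_at_top)
  show "filterlim (\<lambda>N. - int N) at_bot sequentially"
    unfolding filterlim_at_bot
  proof
    fix Z :: int
    show "\<forall>\<^sub>F N in sequentially. - int N \<le> Z"
      using eventually_ge_at_top[of "nat (- Z)"] by eventually_elim linarith
  qed
qed (auto simp: filterlim_int_sequentially)

text \<open>
  Both sides of the Poisson formula are series of this kind: for \<open>z\<close> in a disc of radius \<open>R\<close> the terms
  are bounded by a Gaussian in \<open>n\<close> times an exponential whose exponent is linear in \<open>n\<close>. Uniformity of the symmetric partial sums is what allows the computation of
  Fourier coefficients term by term.
\<close>
lemma gaussian_series: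
  fixes t :: "int \<Rightarrow> complex \<Rightarrow> complex" and a :: real
  assumes a: "a > 0"
    and hol: "\<And>n. t n holomorphic_on UNIV"
    and bound: "\<And>R n z. R \<ge> 0 \<Longrightarrow> norm z \<le> R \<Longrightarrow>
          norm (t n z) \<le> c R * exp (- a * of_int n ^ 2 + d R * \<bar>of_int n\<bar>)"
  shows gaussian_series_has_sum: "((\<lambda>n. t n z) has_sum (\<Sum>\<^sub>\<infinity>n. t n z)) UNIV"
    and gaussian_series_uniform_limit: "uniform_limit (cball 0 R)
          (\<lambda>N z. \<Sum>n\<in>{- int N..int N}. t n z) (\<lambda>z. \<Sum>\<^sub>\<infinity>n. t n z) sequentially"
    and gaussian_series_holomorphic: "(\<lambda>z. \<Sum>\<^sub>\<infinity>n. t n z) holomorphic_on UNIV"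
proof -
  have sm: "(\<lambda>n::int. c R * exp (- a * of_int n ^ 2 + d R * \<bar>of_int n\<bar>)) summable_on UNIV" for R
    by (intro summable_on_cmult_right summable_on_int_gaussian a)
  show "((\<lambda>n. t n z) has_sum (\<Sum>\<^sub>\<infinity>n. t n z)) UNIV"
    by (rule has_sum_infsum[OF abs_summable_summable[OF
          Infinite_Sum.abs_summable_on_comparison_test'[OF sm[of "norm z"]]]], rule bound) auto
  have unif: "uniform_limit (cball 0 R)
          (\<lambda>X z. \<Sum>n\<in>X. t n z) (\<lambda>z. \<Sum>\<^sub>\<infinity>n. t n z) (finite_subsets_at_top UNIV)" for R
  proof (cases "R \<ge> 0")
    case True
    show ?thesis
      by (rule Weierstrass_m_test_general[OF bound[OF True] sm[of R]]) simp
  qed simp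
  show "uniform_limit (cball 0 R)
          (\<lambda>N z. \<Sum>n\<in>{- int N..int N}. t n z) (\<lambda>z. \<Sum>\<^sub>\<infinity>n. t n z) sequentially"
    by (rule filterlim_compose[OF unif filterlim_symmetric_intervals])
  have "(\<lambda>z. \<Sum>\<^sub>\<infinity>n. t n z) holomorphic_on ball 0 R" for R
    by (rule holomorphic_uniform_limit[OF _ unif[of R]])
       (auto intro!: always_eventually continuous_intros holomorphic_intros
             holomorphic_on_imp_continuous_on holomorphic_on_subset[OF hol])
  hence "(\<lambda>z. \<Sum>\<^sub>\<infinity>n. t n z) holomorphic_on (\<Union>R\<in>UNIV. ball 0 (real R))"
    by (intro holomorphic_on_UN_open) auto
  moreover have "(\<Union>R\<in>UNIV. ball (0::complex) (real R)) = UNIV"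
    using reals_Archimedean2 by auto
  ultimately show "(\<lambda>z. \<Sum>\<^sub>\<infinity>n. t n z) holomorphic_on UNIV" by simp
qed

section \<open>Uniqueness of Fourier coefficients\<close>

lemma continuous_on_e [continuous_intros]:
  "continuous_on A f \<Longrightarrow> continuous_on A (\<lambda>x. e (f x))"
  unfolding e_def by (intro continuous_intros)

lemma has_integral_e:
  fixes k :: int
  shows "((\<lambda>x. e (of_int k * x)) has_integral (if k = 0 then 1 else 0)) {-1/2..1/2}"
proof (cases "k = 0")
  case True
  thus ?thesis using has_integral_const_real[of "1::complex" "-1/2" "1/2"] by simp
next
  case False
  define F where "F x = e (of_int k * x) / (2 * of_real pi * \<i> * of_int k)" for x :: real
  have "((\<lambda>x. e (of_int k * x)) has_integral (F (1/2) - F (-1/2))) {-1/2..1/2}"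
  proof (rule fundamental_theorem_of_calculus)
    fix x :: real
    show "(F has_vector_derivative e (of_int k * x)) (at x within {-1/2..1/2})"
      unfolding F_def e_def using False
      by (auto intro!: derivative_eq_intros has_vector_derivative_real_field simp: field_simps)
  qed auto
  moreover have "F (1/2) = F (-1/2)"
  proof -
    have "e (of_int k * (1/2)) = e (of_int k * (-1/2))"
      by (rule e_cong[where n = k]) simp
    thus ?thesis by (simp add: F_def)
  qed
  ultimately show ?thesis using False by simp
qed

text \<open>
  A weak form of the Riemann-Lebesgue lemma. The averages of \<open>e (k x)\<close> over \<open>k < N\<close> are bounded by \<open>1\<close> and
  tend to \<open>0\<close> for \<open>x \<noteq> 0\<close>, so dominated convergence applies. The sign \<open>r\<close> selects positive or negative
  frequencies.
\<close>
lemma fourier_coeff_average_tendsto_0: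
  fixes q :: "real \<Rightarrow> complex" and r :: int
  assumes q: "continuous_on {-1/2..1/2} q" and r: "\<bar>r\<bar> = 1"
  shows "(\<lambda>N. \<Sum>k<N. integral {-1/2..1/2} (\<lambda>x. q x * e (of_int (r * int k) * x)) / of_nat N) \<longlonglongrightarrow> 0"
proof -
  let ?I = "{-1/2..1/2::real}"
  define g where "g N x = (if x = 0 then 0 else q x * (\<Sum>k<N. e (of_int (r * int k) * x)) / of_nat N)" for N x
  have integrable: "(\<lambda>x. q x * e (of_int (r * int k) * x)) integrable_on ?I" for k
    by (intro integrable_continuous_interval continuous_intros q)
  have "((\<lambda>x. \<Sum>k<N. q x * e (of_int (r * int k) * x) / of_nat N) has_integral
         (\<Sum>k<N. integral ?I (\<lambda>x. q x * e (of_int (r * int k) * x)) / of_nat N)) ?I" for N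
    by (intro has_integral_sum has_integral_divide integrable_integral integrable) auto
  hence *: "(g N has_integral (\<Sum>k<N. integral ?I (\<lambda>x. q x * e (of_int (r * int k) * x)) / of_nat N)) ?I" for N
    by (rule has_integral_spike[of "{0}", rotated 2])
       (auto simp: g_def sum_distrib_left sum_divide_distrib)
  have "bounded (q ` ?I)"
    by (intro compact_imp_bounded compact_continuous_image q) auto
  then obtain B where B: "B > 0" "\<And>x. x \<in> ?I \<Longrightarrow> norm (q x) \<le> B"
    unfolding bounded_pos by auto
  have D_le: "norm (\<Sum>k<N. e (of_int (r * int k) * x)) \<le> of_nat N" for N x
    using norm_sum[of "\<lambda>k. e (of_int (r * int k) * x)" "{..<N}"] by simp
  have "(\<lambda>N. integral ?I (g N)) \<longlonglongrightarrow> integral ?I (\<lambda>_. 0)"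
  proof (rule dominated_convergence)
    show "g N integrable_on ?I" for N using * by blast
    show "(\<lambda>_. B) integrable_on ?I" by (rule integrable_const_ivl)
    fix N x assume x: "x \<in> ?I"
    have "norm (q x) * (norm (\<Sum>k<N. e (of_int (r * int k) * x)) / of_nat N) \<le> B * 1"
      using B x D_le[of x N] by (intro mult_mono) (auto simp: divide_le_eq_1)
    thus "norm (g N x) \<le> B" using B(1) by (simp add: g_def norm_mult norm_divide)
  next
    fix x assume x: "x \<in> ?I"
    show "(\<lambda>N. g N x) \<longlonglongrightarrow> 0"
    proof (cases "x = 0")
      case False
      define z where "z = e (of_int r * x)"
      have "z \<noteq> 1"
      proof
        assume "z = 1"
        then obtain j where j: "of_int r * x = of_int j"
          unfolding z_def e_eq_1_iff by (auto elim: Ints_cases)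
        have "\<bar>of_int j :: real\<bar> = \<bar>x\<bar>" 
          using arg_cong[OF r, of real_of_int] by (simp flip: j add: abs_mult)
        with x False have "\<bar>of_int j :: real\<bar> < 1" "j \<noteq> 0" by auto
        thus False by linarith
      qed
      have D: "(\<Sum>k<N. e (of_int (r * int k) * x)) = (1 - z ^ N) / (1 - z)" for N
      proof -
        have "e (of_int (r * int k) * x) = z ^ k" for k
          by (simp add: z_def e_power mult_ac)
        thus ?thesis using \<open>z \<noteq> 1\<close> by (simp add: sum_gp_strict)
      qed
      have "norm (g N x) \<le> norm (q x) * (2 / norm (1 - z)) / of_nat N" for N
      proof -
        have "norm (1 - z ^ N) \<le> 2"
          using norm_triangle_ineq4[of 1 "z ^ N"] by (simp add: z_def norm_power)
        hence "norm (q x) * (norm (1 - z ^ N) / norm (1 - z)) / of_nat N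
             \<le> norm (q x) * (2 / norm (1 - z)) / of_nat N"
          by (intro divide_right_mono mult_left_mono) auto
        moreover have "g N x = q x * ((1 - z ^ N) / (1 - z)) / of_nat N"
          using False unfolding g_def D by simp
        ultimately show ?thesis by (simp add: norm_mult norm_divide)
      qed
      thus ?thesis
        by (rule Lim_null_comparison[OF always_eventually, rule_format])
           (rule lim_const_over_n)
    qed (simp add: g_def)
  qed
  moreover have "integral ?I (g N) = (\<Sum>k<N. integral ?I (\<lambda>x. q x * e (of_int (r * int k) * x)) / of_nat N)" for N
    by (rule integral_unique[OF *])
  ultimately show ?thesis by (simp only: integral_0)
qed

lemma vector_derivative_quotient_tendsto:
  fixes f :: "real \<Rightarrow> complex"
  assumes "(f has_vector_derivative D) (at x)"
  shows "((\<lambda>y. (f y - f x) / of_real (y - x)) \<longlongrightarrow> D) (at x)"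
proof -
  have "((\<lambda>y. norm (f y - f x - (y - x) *\<^sub>R D) / norm (y - x)) \<longlongrightarrow> 0) (at x)"
    using assms by (simp add: has_vector_derivative_def has_derivative_iff_norm)
  moreover have "\<forall>\<^sub>F y in at x. norm (f y - f x - (y - x) *\<^sub>R D) / norm (y - x)
      = norm ((f y - f x) / of_real (y - x) - D)"
  proof (unfold eventually_at_filter, intro always_eventually allI impI)
    fix y assume "y \<noteq> x"
    hence "(f y - f x - (y - x) *\<^sub>R D) / of_real (y - x) = (f y - f x) / of_real (y - x) - D"
      by (simp add: scaleR_conv_of_real field_simps)
    from arg_cong[OF this, of norm]
    show "norm (f y - f x - (y - x) *\<^sub>R D) / norm (y - x) = norm ((f y - f x) / of_real (y - x) - D)"
      by (simp only: norm_divide norm_of_real real_norm_def)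
  qed
  ultimately have "((\<lambda>y. norm ((f y - f x) / of_real (y - x) - D)) \<longlongrightarrow> 0) (at x)"
    by (simp add: tendsto_cong)
  thus ?thesis by (simp add: tendsto_norm_zero_iff LIM_zero_cancel)
qed

text \<open>
  Chernoff's argument. The quotient \<open>q x = (f x - f 0) / (e x - 1)\<close> is continuous because \<open>f\<close> is
  differentiable at \<open>0\<close>. Multiplication by \<open>e x - 1\<close> is a difference operator on Fourier coefficients;
  as those of \<open>f\<close> vanish, the coefficients of \<open>q\<close> are constant apart from a single jump of height
  \<open>- f 0\<close> at frequency \<open>0\<close>. Both constants are \<open>0\<close> by lemma \<open>fourier_coeff_average_tendsto_0\<close>, hence so is the jump.
\<close>
lemma fourier_uniqueness_at_0:
  fixes f :: "real \<Rightarrow> complex"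
  assumes cont: "continuous_on {-1/2..1/2} f"
    and deriv: "(f has_vector_derivative D) (at 0)"
    and coeff: "\<And>k::int. ((\<lambda>x. f x * e (of_int k * x)) has_integral 0) {-1/2..1/2}"
  shows "f 0 = 0"
proof -
  let ?I = "{-1/2..1/2::real}"
  define q where "q x = (if x = 0 then D / (2 * of_real pi * \<i>) else (f x - f 0) / (e x - 1))" for x
  have e_ne: "e x \<noteq> 1" if "x \<in> ?I" "x \<noteq> 0" for x
  proof
    assume "e x = 1"
    then obtain n where "x = of_int n" by (auto simp: e_eq_1_iff elim: Ints_cases)
    thus False using that by auto
  qed
  have "continuous (at x within ?I) q" if x: "x \<in> ?I" for x
  proof (cases "x = 0")
    case False
    have "continuous (at x within ?I) (\<lambda>x. (f x - f 0) / (e x - 1))"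
      using cont x continuous_on_e[OF continuous_on_id] e_ne[OF x False]
      by (intro continuous_intros) (auto simp: continuous_on_eq_continuous_within)
    moreover have "\<forall>\<^sub>F y in at x within ?I. (f y - f 0) / (e y - 1) = q y"
      using tendsto_imp_eventually_ne[OF tendsto_ident_at False]
      by eventually_elim (simp add: q_def)
    ultimately show ?thesis
      using False tendsto_cong by (fastforce simp: continuous_within q_def[of x])
  next
    case True
    have "(e has_vector_derivative 2 * of_real pi * \<i>) (at 0)"
    proof -
      have "((\<lambda>z. exp (2 * of_real pi * \<i> * z)) has_field_derivative 2 * of_real pi * \<i>) (at (of_real 0))"
        by (auto intro!: derivative_eq_intros)
      from has_vector_derivative_real_field[OF this] show ?thesis
        by (simp add: e_def[abs_def])
    qed
    hence "((\<lambda>y. (e y - e 0) / of_real (y - 0)) \<longlongrightarrow> 2 * of_real pi * \<i>) (at 0)"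
      by (rule vector_derivative_quotient_tendsto)
    with vector_derivative_quotient_tendsto[OF deriv]
    have "((\<lambda>y. ((f y - f 0) / of_real (y - 0)) / ((e y - e 0) / of_real (y - 0)))
        \<longlongrightarrow> D / (2 * of_real pi * \<i>)) (at 0)"
      by (intro tendsto_divide) auto
    hence "((\<lambda>y. ((f y - f 0) / of_real (y - 0)) / ((e y - e 0) / of_real (y - 0)))
        \<longlongrightarrow> D / (2 * of_real pi * \<i>)) (at 0 within ?I)"
      by (rule tendsto_within_subset) auto
    moreover have "\<forall>\<^sub>F y in at 0 within ?I.
        ((f y - f 0) / of_real (y - 0)) / ((e y - e 0) / of_real (y - 0)) = q y"
      by (auto simp: eventually_at_filter q_def)
    ultimately have "(q \<longlongrightarrow> q 0) (at 0 within ?I)"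
      using tendsto_cong by (fastforce simp: q_def[of 0])
    thus ?thesis using True by (simp add: continuous_within)
  qed
  hence q: "continuous_on ?I q"
    by (simp add: continuous_on_eq_continuous_within)
  have q_eq: "q x * (e x - 1) = f x - f 0" if "x \<in> ?I" for x
    using e_ne[OF that] by (auto simp: q_def)
  define c where "c k = integral ?I (\<lambda>x. q x * e (of_int k * x))" for k :: int
  have c: "((\<lambda>x. q x * e (of_int k * x)) has_integral c k) ?I" for k
    unfolding c_def by (intro integrable_integral integrable_continuous_interval continuous_intros q)
  have jump: "c (k + 1) - c k = (if k = 0 then - f 0 else 0)" for k
  proof -
    have "((\<lambda>x. f x * e (of_int k * x) - f 0 * e (of_int k * x)) has_integral
            0 - f 0 * (if k = 0 then 1 else 0)) ?I"
      by (intro has_integral_diff coeff has_integral_mult_right has_integral_e)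
    also have "?this \<longleftrightarrow> ((\<lambda>x. q x * e (of_int (k + 1) * x) - q x * e (of_int k * x)) has_integral
            0 - f 0 * (if k = 0 then 1 else 0)) ?I"
    proof (rule has_integral_cong)
      fix x assume x: "x \<in> ?I"
      have "f x * e (of_int k * x) - f 0 * e (of_int k * x) = q x * (e x - 1) * e (of_int k * x)"
        unfolding q_eq[OF x] by (simp add: algebra_simps)
      thus "f x * e (of_int k * x) - f 0 * e (of_int k * x) = q x * e (of_int (k + 1) * x) - q x * e (of_int k * x)"
        by (simp add: algebra_simps e_add)
    qed
    finally have "c (k + 1) - c k = 0 - f 0 * (if k = 0 then 1 else 0)"
      using has_integral_diff[OF c[of "k + 1"] c[of k]] by (rule has_integral_unique[rotated])
    thus ?thesis by simp
  qed
  have pos: "c (int n + 1) = c 1" for n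
  proof (induction n)
    case (Suc n)
    thus ?case using jump[of "int n + 1"] by (simp add: add_ac)
  qed simp
  have neg: "c (- int n) = c 0" for n
  proof (induction n)
    case (Suc n)
    have eq: "- int (Suc n) = - int n - 1" by simp
    show ?case unfolding eq using Suc jump[of "- int n - 1"] by simp
  qed simp
  have const_0: "a = 0" if "(\<lambda>N. \<Sum>k<N. a / of_nat N) \<longlonglongrightarrow> 0" for a :: complex
  proof -
    have "(\<lambda>N. \<Sum>k<Suc N. a / of_nat (Suc N)) \<longlonglongrightarrow> 0"
      using that by (rule LIMSEQ_Suc)
    moreover have "(\<Sum>k<Suc N. a / of_nat (Suc N)) = a" for N
      by (simp del: of_nat_Suc sum.lessThan_Suc)
    ultimately show ?thesis by (simp add: LIMSEQ_const_iff)
  qed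
  have "c 0 = 0"
  proof (rule const_0)
    have eq: "integral ?I (\<lambda>x. q x * e (of_int (- 1 * int k) * x)) = c 0" for k
      using neg[of k] unfolding c_def by simp
    show "(\<lambda>N. \<Sum>k<N. c 0 / of_nat N) \<longlonglongrightarrow> 0"
      using fourier_coeff_average_tendsto_0[OF q, of "- 1"] unfolding eq by simp
  qed
  moreover have "c 1 = 0"
  proof (rule const_0)
    have "continuous_on ?I (\<lambda>x. q x * e x)" by (intro continuous_intros q)
    from fourier_coeff_average_tendsto_0[OF this, of 1]
    have "(\<lambda>N. \<Sum>k<N. integral ?I (\<lambda>x. q x * e x * e (of_int (int k) * x)) / of_nat N) \<longlonglongrightarrow> 0"
      by simp
    moreover have "integral ?I (\<lambda>x. q x * e x * e (of_int (int k) * x)) = c 1" for k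
    proof -
      have "q x * e x * e (of_int (int k) * x) = q x * e (of_int (int k + 1) * x)" for x
        by (simp add: ring_distribs e_add mult_ac)
      thus ?thesis using pos[of k] unfolding c_def by (simp only:)
    qed
    ultimately show "(\<lambda>N. \<Sum>k<N. c 1 / of_nat N) \<longlonglongrightarrow> 0" by simp
  qed
  ultimately show ?thesis using jump[of 0] by simp
qed

section \<open>Poisson summation for Gaussians\<close>

text \<open>
  This is the characteristic function of the standard normal distribution after scaling by
  \<open>c = sqrt (2 \<pi> \<tau>)\<close>.
\<close>
lemma gaussian_fourier_transform:
  fixes \<tau> k :: real
  assumes "\<tau> > 0"
  shows "integrable lborel (\<lambda>x. of_real (exp (- pi * \<tau> * x ^ 2)) * e (- k * x))" (is ?A)
    and "(LBINT x. of_real (exp (- pi * \<tau> * x ^ 2)) * e (- k * x))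
           = of_real (exp (- pi * k ^ 2 / \<tau>) / sqrt \<tau>)" (is ?B)
proof -
  define c where "c = sqrt (2 * pi * \<tau>)"
  have c: "c > 0" "c ^ 2 = 2 * pi * \<tau>" using assms by (simp_all add: c_def)
  define t where "t = - 2 * pi * k / c"
  define g where "g x = std_normal_density x *\<^sub>R iexp (t * x)" for x
  have g_eq: "g (0 + c * x) = of_real (1 / sqrt (2 * pi)) * (of_real (exp (- pi * \<tau> * x ^ 2)) * e (- k * x))" for x
  proof -
    have "(c * x) ^ 2 / 2 = pi * \<tau> * x ^ 2" using c(2) by (simp add: power_mult_distrib)
    moreover have "t * (c * x) = - 2 * pi * k * x" using c(1) by (simp add: t_def)
    ultimately show ?thesis
      by (simp add: g_def std_normal_density_def e_def scaleR_conv_of_real mult_ac)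
  qed
  have int: "integrable lborel g"
  proof (rule Bochner_Integration.integrable_bound)
    show "integrable lborel std_normal_density" by simp
    show "g \<in> borel_measurable lborel" unfolding g_def by measurable
  qed (simp add: g_def norm_mult)
  have "(LBINT x. g x) = char std_normal_distribution t"
    unfolding char_def g_def by (subst integral_density) (auto simp: complex_eq_iff)
  also have "\<dots> = of_real (exp (- (t ^ 2) / 2))"
    by (simp add: char_std_normal_distribution)
  also have "t ^ 2 / 2 = pi * k ^ 2 / \<tau>"
    using assms c by (simp add: t_def power_divide power_mult_distrib field_simps power2_eq_square)
  hence "- (t ^ 2) / 2 = - pi * k ^ 2 / \<tau>" by simp
  finally have val: "(LBINT x. g x) = of_real (exp (- pi * k ^ 2 / \<tau>))" .
  have "integrable lborel (\<lambda>x. g (0 + c * x))"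
    using int c(1) by (subst lborel_integrable_real_affine_iff) auto
  hence "integrable lborel (\<lambda>x. of_real (sqrt (2 * pi)) * g (0 + c * x))"
    by (rule integrable_mult_right)
  moreover have "complex_of_real (sqrt (2 * pi)) * (of_real (1 / sqrt (2 * pi)) * z) = z" for z
    by simp
  ultimately show ?A unfolding g_eq by (simp only:)
  have "of_real (exp (- pi * k ^ 2 / \<tau>)) = \<bar>c\<bar> *\<^sub>R (LBINT x. g (0 + c * x))"
    using c(1) unfolding val[symmetric] by (intro lborel_integral_real_affine) auto
  also have "\<dots> = of_real (c / sqrt (2 * pi)) * (LBINT x. of_real (exp (- pi * \<tau> * x ^ 2)) * e (- k * x))"
    using c(1) unfolding g_eq by (simp add: scaleR_conv_of_real)
  also have "c / sqrt (2 * pi) = sqrt \<tau>"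
    by (simp add: c_def real_sqrt_mult)
  finally show ?B using assms by (simp add: field_simps)
qed

lemma set_integral_symmetric_tendsto:
  fixes f :: "real \<Rightarrow> complex"
  assumes "integrable lborel f"
  shows "(\<lambda>N. LBINT x:{- real N - 1/2..real N + 1/2}. f x) \<longlonglongrightarrow> (LBINT x. f x)"
  unfolding set_lebesgue_integral_def
proof (rule integral_dominated_convergence)
  show "integrable lborel (\<lambda>x. norm (f x))" using assms by simp
  show "AE x in lborel. (\<lambda>N. indicator {- real N - 1/2..real N + 1/2} x *\<^sub>R f x) \<longlonglongrightarrow> f x"
  proof (rule AE_I2)
    fix x :: real
    obtain N where N: "\<bar>x\<bar> \<le> real N" using real_arch_simple by blast
    have "\<forall>\<^sub>F n in sequentially. indicator {- real n - 1/2..real n + 1/2} x *\<^sub>R f x = f x"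
      using eventually_ge_at_top[of N]
    proof eventually_elim
      case (elim n)
      hence "\<bar>x\<bar> \<le> real n" using N by (meson of_nat_mono order_trans)
      hence "x \<in> {- real n - 1/2..real n + 1/2}" by auto
      thus ?case by simp
    qed
    thus "(\<lambda>N. indicator {- real N - 1/2..real N + 1/2} x *\<^sub>R f x) \<longlonglongrightarrow> f x"
      by (rule tendsto_eventually)
  qed
qed (use assms in \<open>auto simp: indicator_def\<close>)

text \<open>
  Integrating a periodisation over one period unfolds to an integral over a long interval.
\<close>
lemma integral_symmetric_intervals:
  fixes f :: "real \<Rightarrow> complex"
  assumes "continuous_on UNIV f"
  shows "integral {-1/2..1/2} (\<lambda>x. \<Sum>n\<in>{- int N..int N}. f (x + of_int n))
       = integral {- real N - 1/2..real N + 1/2} f"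
proof (induction N)
  case (Suc N)
  have cont: "continuous_on A f" for A using assms continuous_on_subset by blast
  have int: "f integrable_on {a..b}" for a b
    by (intro integrable_continuous_interval cont)
  have cont': "continuous_on A (\<lambda>x. f (x + c))" for A c
    by (intro continuous_on_compose2[OF assms] continuous_intros) auto
  have int': "(\<lambda>x. f (x + c)) integrable_on {a..b}" for a b c
    by (intro integrable_continuous_interval cont')
  have shift: "integral {-1/2..1/2} (\<lambda>x. f (x + c)) = integral {c - 1/2..c + 1/2} f" for c
    using integral_shift[of "-1/2" c "1/2" f] cont by (simp add: o_def add.commute)
  have set: "{- int (Suc N)..int (Suc N)} = insert (- int (Suc N)) (insert (int (Suc N)) {- int N..int N})"
    by auto
  have "integral {-1/2..1/2} (\<lambda>x. \<Sum>n\<in>{- int (Suc N)..int (Suc N)}. f (x + of_int n))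
      = integral {-1/2..1/2} (\<lambda>x. f (x + of_int (- int (Suc N))) + (f (x + of_int (int (Suc N)))
          + (\<Sum>n\<in>{- int N..int N}. f (x + of_int n))))"
    unfolding set by (subst sum.insert; simp)+
  also have "\<dots> = integral {-1/2..1/2} (\<lambda>x. f (x + of_int (- int (Suc N))))
      + (integral {-1/2..1/2} (\<lambda>x. f (x + of_int (int (Suc N))))
      + integral {-1/2..1/2} (\<lambda>x. \<Sum>n\<in>{- int N..int N}. f (x + of_int n)))"
    by (subst integral_add; (intro integrable_add int' integrable_sum)?; simp?)+
  also have "\<dots> = integral {- real (Suc N) - 1/2..- real N - 1/2} f
      + (integral {real N + 1/2..real (Suc N) + 1/2} f + integral {- real N - 1/2..real N + 1/2} f)"
  proof -
    have "of_int (- int (Suc N)) + 1/2 = - real N - 1/2" "of_int (int (Suc N)) - 1/2 = real N + 1/2"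
      by simp_all
    thus ?thesis unfolding Suc.IH shift by (simp only: of_int_minus of_int_of_nat_eq)
  qed
  also have "\<dots> = integral {- real (Suc N) - 1/2..- real N - 1/2} f
      + integral {- real N - 1/2..real (Suc N) + 1/2} f"
    using Henstock_Kurzweil_Integration.integral_combine[of "- real N - 1/2" "real N + 1/2" "real (Suc N) + 1/2" f] int
    by (simp add: add.commute)
  also have "\<dots> = integral {- real (Suc N) - 1/2..real (Suc N) + 1/2} f"
    by (rule Henstock_Kurzweil_Integration.integral_combine) (auto intro: int)
  finally show ?case .
qed simp

text \<open>
  Poisson summation for \<open>exp (- \<pi> \<tau> x\<^sup>2)\<close>. Both sides extend to entire functions \<open>FA\<close> and \<open>FB\<close> of a
  displacement \<open>z\<close> of \<open>x\<close>. On the real line these have the same Fourier coefficients: for \<open>FA\<close> they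
  unfold to the Fourier transform of the Gaussian, for \<open>FB\<close> they can be read off. The uniqueness lemma
  for the difference at \<open>z = 0\<close> gives the claim.
\<close>
theorem poisson_gaussian:
  fixes \<tau> x :: real
  assumes \<tau>: "\<tau> > 0"
  shows "\<exists>S. ((\<lambda>n::int. of_real (exp (- pi * \<tau> * (x + of_int n) ^ 2))) has_sum S) UNIV \<and>
             ((\<lambda>n::int. of_real (exp (- pi * of_int n ^ 2 / \<tau>) / sqrt \<tau>) * e (of_int n * x)) has_sum S) UNIV"
proof -
  define tA where "tA n z = exp (- of_real (pi * \<tau>) * (of_real x + z + of_int n) ^ 2)" for n :: int and z :: complex
  define c where "c n = exp (- pi * of_int n ^ 2 / \<tau>) / sqrt \<tau>" for n :: int
  define tB where "tB n z = of_real (c n) * exp (2 * of_real pi * \<i> * of_int n * (of_real x + z))"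
    for n :: int and z :: complex
  have A: "norm (tA n z) \<le> exp (pi * \<tau> * (\<bar>x\<bar> + R) ^ 2) *
      exp (- (pi * \<tau>) * of_int n ^ 2 + (2 * pi * \<tau> * (\<bar>x\<bar> + R)) * \<bar>of_int n\<bar>)"
    if "R \<ge> 0" "norm z \<le> R" for R n z
  proof -
    define w where "w = of_real x + z"
    have w: "norm w \<le> \<bar>x\<bar> + R"
      unfolding w_def using that(2) norm_triangle_ineq[of "of_real x" z] by simp
    have "Re ((w + of_int n) ^ 2) = (Re w + of_int n) ^ 2 - (Im w) ^ 2"
      by (simp add: power2_eq_square)
    also have "\<dots> \<ge> of_int n ^ 2 - 2 * (\<bar>x\<bar> + R) * \<bar>of_int n\<bar> - (\<bar>x\<bar> + R) ^ 2"
    proof -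
      have "\<bar>Re w * of_int n\<bar> \<le> (\<bar>x\<bar> + R) * \<bar>of_int n\<bar>"
        unfolding abs_mult using w abs_Re_le_cmod[of w] by (intro mult_right_mono) auto
      moreover have "(Im w) ^ 2 \<le> (\<bar>x\<bar> + R) ^ 2"
        using w abs_Im_le_cmod[of w] by (intro abs_le_square_iff[THEN iffD1]) auto
      moreover have "(Re w + of_int n) ^ 2 \<ge> 2 * (Re w * of_int n) + of_int n ^ 2"
        by (simp add: power2_sum)
      ultimately show ?thesis by (simp add: abs_le_iff algebra_simps)
    qed
    finally have "- (pi * \<tau>) * Re ((w + of_int n) ^ 2)
        \<le> - (pi * \<tau>) * (of_int n ^ 2 - 2 * (\<bar>x\<bar> + R) * \<bar>of_int n\<bar> - (\<bar>x\<bar> + R) ^ 2)"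
      using \<tau> by (intro mult_left_mono_neg) auto
    also have "\<dots> = pi * \<tau> * (\<bar>x\<bar> + R) ^ 2 + (- (pi * \<tau>) * of_int n ^ 2 + (2 * pi * \<tau> * (\<bar>x\<bar> + R)) * \<bar>of_int n\<bar>)"
      by (simp add: algebra_simps)
    finally have "exp (- (pi * \<tau>) * Re ((w + of_int n) ^ 2)) \<le> exp \<dots>" by simp
    moreover have "norm (tA n z) = exp (- (pi * \<tau>) * Re ((w + of_int n) ^ 2))"
      unfolding tA_def w_def[symmetric] norm_exp_eq_Re by simp
    ultimately show ?thesis by (simp only: exp_add)
  qed
  have B: "norm (tB n z) \<le> 1 / sqrt \<tau> * exp (- (pi / \<tau>) * of_int n ^ 2 + (2 * pi * R) * \<bar>of_int n\<bar>)"
    if "R \<ge> 0" "norm z \<le> R" for R n z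
  proof -
    have "\<bar>of_int n * Im z\<bar> \<le> \<bar>of_int n\<bar> * R"
      unfolding abs_mult using that abs_Im_le_cmod[of z] by (intro mult_left_mono) auto
    hence "- (of_int n * Im z) \<le> R * \<bar>of_int n\<bar>" by (simp add: abs_le_iff mult.commute)
    hence "2 * pi * (- (of_int n * Im z)) \<le> 2 * pi * (R * \<bar>of_int n\<bar>)"
      by (intro mult_left_mono) auto
    moreover have "norm (tB n z) = 1 / sqrt \<tau> * exp (- (pi / \<tau>) * of_int n ^ 2 + 2 * pi * (- (of_int n * Im z)))"
    proof -
      have "norm (tB n z) = c n * exp (Re (2 * of_real pi * \<i> * of_int n * (of_real x + z)))"
        using \<tau> by (simp only: tB_def norm_mult norm_exp_eq_Re norm_of_real) (simp add: c_def)
      also have "Re (2 * of_real pi * \<i> * of_int n * (of_real x + z)) = 2 * pi * (- (of_int n * Im z))"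
        by simp
      finally show ?thesis unfolding exp_add by (simp add: c_def)
    qed
    ultimately show ?thesis using \<tau> by (simp add: mult.assoc divide_right_mono)
  qed
  have holA: "tA n holomorphic_on UNIV" and holB: "tB n holomorphic_on UNIV" for n
    unfolding tA_def[abs_def] tB_def[abs_def] by (intro holomorphic_intros)+
  have a: "pi * \<tau> > 0" "pi / \<tau> > 0" using \<tau> by auto
  note GA = gaussian_series[where t = tA and c = "\<lambda>R. exp (pi * \<tau> * (\<bar>x\<bar> + R) ^ 2)"
      and d = "\<lambda>R. 2 * pi * \<tau> * (\<bar>x\<bar> + R)", OF a(1) holA A]
  note GB = gaussian_series[where t = tB and c = "\<lambda>R. 1 / sqrt \<tau>" and d = "\<lambda>R. 2 * pi * R", OF a(2) holB B]
  define FA FB where "FA z = (\<Sum>\<^sub>\<infinity>n. tA n z)" and "FB z = (\<Sum>\<^sub>\<infinity>n. tB n z)" for z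
  define f where "f y = FA (of_real y) - FB (of_real y)" for y :: real
  have hol: "(\<lambda>z. FA z - FB z) holomorphic_on UNIV"
    unfolding FA_def FB_def by (intro holomorphic_on_diff GA(3) GB(3))
  let ?I = "{-1/2..1/2::real}"
  have "f 0 = 0"
  proof (rule fourier_uniqueness_at_0)
    show "continuous_on ?I f" unfolding f_def
      by (rule continuous_on_compose2[OF holomorphic_on_imp_continuous_on[OF hol]])
         (auto intro!: continuous_intros)
    have "((\<lambda>z. FA z - FB z) has_field_derivative deriv (\<lambda>z. FA z - FB z) (of_real 0)) (at (of_real 0))"
      by (rule holomorphic_derivI[OF hol]) auto
    from has_vector_derivative_real_field[OF this]
    show "(f has_vector_derivative deriv (\<lambda>z. FA z - FB z) (of_real 0)) (at 0)"
      by (simp add: f_def[abs_def])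
    fix k :: int
    have sub: "of_real ` ?I \<subseteq> cball (0::complex) 1" by auto
    have unif: "uniform_limit ?I (\<lambda>N y. (\<Sum>n\<in>{- int N..int N}. t n (of_real y)) * e (of_int k * y))
        (\<lambda>y. F (of_real y) * e (of_int k * y)) sequentially"
      if "uniform_limit (cball 0 1) (\<lambda>N z. \<Sum>n\<in>{- int N..int N}. t n z) F sequentially"
        "F holomorphic_on UNIV"
      for t :: "int \<Rightarrow> complex \<Rightarrow> complex" and F
    proof (rule uniform_lim_mult)
      show "uniform_limit ?I (\<lambda>N y. \<Sum>n\<in>{- int N..int N}. t n (of_real y)) (\<lambda>y. F (of_real y)) sequentially"
        using uniform_limit_compose'[OF that(1), of of_real ?I] sub by auto
      show "uniform_limit ?I (\<lambda>N y. e (of_int k * y)) (\<lambda>y. e (of_int k * y)) sequentially"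
        by (rule uniform_limit_const)
      show "bounded ((\<lambda>y. F (of_real y)) ` ?I)"
        by (intro compact_imp_bounded compact_continuous_image
              continuous_on_compose2[OF holomorphic_on_imp_continuous_on[OF that(2)]] continuous_intros) auto
      show "bounded ((\<lambda>y. e (of_int k * y)) ` ?I)"
        by (intro compact_imp_bounded compact_continuous_image continuous_intros) auto
    qed
    \<comment> \<open>The common Fourier coefficient at frequency \<open>- k\<close>; the displacement by \<open>x\<close> contributes the phase.\<close>
    define v where "v = e (- (of_int k * x)) * of_real (c (- k))"
    have coeff: "((\<lambda>y. F (of_real y) * e (of_int k * y)) has_integral v) ?I"
      if u: "uniform_limit (cball 0 1) (\<lambda>N z. \<Sum>n\<in>{- int N..int N}. t n z) F sequentially"
        and h: "F holomorphic_on UNIV" "\<And>n. t n holomorphic_on UNIV"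
        and lim: "(\<lambda>N. integral ?I (\<lambda>y. (\<Sum>n\<in>{- int N..int N}. t n (of_real y)) * e (of_int k * y))) \<longlonglongrightarrow> v"
      for t :: "int \<Rightarrow> complex \<Rightarrow> complex" and F
    proof (rule uniform_limit_integral[OF unif[OF u h(1)]])
      show "continuous_on ?I (\<lambda>y. (\<Sum>n\<in>{- int N..int N}. t n (of_real y)) * e (of_int k * y))" for N
        by (intro continuous_intros continuous_on_compose2[OF holomorphic_on_imp_continuous_on[OF h(2)]]) auto
      fix I J assume IJ: "\<And>N. ((\<lambda>y. (\<Sum>n\<in>{- int N..int N}. t n (of_real y)) * e (of_int k * y)) has_integral I N) ?I"
        "((\<lambda>y. F (of_real y) * e (of_int k * y)) has_integral J) ?I" "I \<longlonglongrightarrow> J"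
      have "I \<longlonglongrightarrow> v" using lim unfolding integral_unique[OF IJ(1)] .
      hence "J = v" using IJ(3) LIMSEQ_unique by blast
      thus ?thesis using IJ(2) by simp
    qed simp
    have "((\<lambda>y. FA (of_real y) * e (of_int k * y)) has_integral v) ?I"
      unfolding FA_def
    proof (rule coeff[OF GA(2) GA(3) holA])
      define g where "g y = of_real (exp (- pi * \<tau> * (x + y) ^ 2)) * e (of_int k * y)" for y
      have g: "tA n (of_real y) * e (of_int k * y) = g (y + of_int n)" for n y
      proof -
        have "e (of_int k * (y + of_int n)) = e (of_int k * y)"
          by (rule e_cong[where n = "k * n"]) (simp add: algebra_simps)
        thus ?thesis
          by (simp add: g_def tA_def exp_of_real[symmetric] add_ac)
      qed
      have shift: "e (- (of_int k * x)) * (of_real (exp (- pi * \<tau> * (x + 1 * y) ^ 2)) * e (- (of_int (- k)) * (x + 1 * y))) = g y" for y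
      proof -
        have "e (- (of_int k * x)) * e (- (of_int (- k)) * (x + 1 * y)) = e (of_int k * y)"
          unfolding e_add[symmetric] by (simp add: algebra_simps)
        thus ?thesis by (simp add: g_def mult_ac)
      qed
      note G = gaussian_fourier_transform[OF \<tau>, of "of_int (- k)"]
      have "integrable lborel (\<lambda>y. of_real (exp (- pi * \<tau> * (x + 1 * y) ^ 2)) * e (- (of_int (- k)) * (x + 1 * y)))"
        using G(1) by (subst lborel_integrable_real_affine_iff) auto
      from integrable_mult_right[OF this, of "e (- (of_int k * x))"]
      have int: "integrable lborel g" unfolding shift .
      have "(LBINT y. g y) = e (- (of_int k * x)) *
          (LBINT y. of_real (exp (- pi * \<tau> * (x + 1 * y) ^ 2)) * e (- (of_int (- k)) * (x + 1 * y)))"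
        unfolding shift[symmetric] by simp
      also have "\<dots> = v"
        using lborel_integral_real_affine[of 1 "\<lambda>y. of_real (exp (- pi * \<tau> * y ^ 2)) * e (- (of_int (- k)) * y)" x] G(2)
        by (simp add: v_def c_def)
      finally have "(LBINT y. g y) = v" .
      with set_integral_symmetric_tendsto[OF int]
      have "(\<lambda>N. LBINT y:{- real N - 1/2..real N + 1/2}. g y) \<longlonglongrightarrow> v" by simp
      moreover have "(LBINT y:{- real N - 1/2..real N + 1/2}. g y)
          = integral ?I (\<lambda>y. (\<Sum>n\<in>{- int N..int N}. tA n (of_real y)) * e (of_int k * y))" for N
      proof -
        have "continuous_on UNIV g" unfolding g_def by (intro continuous_intros)
        from integral_symmetric_intervals[OF this, of N]
        have "integral ?I (\<lambda>y. (\<Sum>n\<in>{- int N..int N}. tA n (of_real y)) * e (of_int k * y))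
            = integral {- real N - 1/2..real N + 1/2} g"
          by (simp add: sum_distrib_right g)
        also have "\<dots> = (LBINT y:{- real N - 1/2..real N + 1/2}. g y)"
          by (intro set_borel_integral_eq_integral(2)[symmetric])
             (auto simp: set_integrable_def intro!: integrable_mult_indicator int)
        finally show ?thesis ..
      qed
      ultimately show "(\<lambda>N. integral ?I (\<lambda>y. (\<Sum>n\<in>{- int N..int N}. tA n (of_real y)) * e (of_int k * y))) \<longlonglongrightarrow> v"
        by simp
    qed
    moreover have "((\<lambda>y. FB (of_real y) * e (of_int k * y)) has_integral v) ?I"
      unfolding FB_def
    proof (rule coeff[OF GB(2) GB(3) holB])
      have "integral ?I (\<lambda>y. (\<Sum>n\<in>{- int N..int N}. tB n (of_real y)) * e (of_int k * y)) = v"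
        if N: "N \<ge> nat \<bar>k\<bar>" for N
      proof -
        have eq: "tB n (of_real y) * e (of_int k * y) = of_real (c n) * e (of_int n * x) * e (of_int (n + k) * y)" for n y
          by (simp add: tB_def e_def exp_add[symmetric] algebra_simps)
        have "((\<lambda>y. \<Sum>n\<in>{- int N..int N}. of_real (c n) * e (of_int n * x) * e (of_int (n + k) * y)) has_integral
             (\<Sum>n\<in>{- int N..int N}. of_real (c n) * e (of_int n * x) * (if n + k = 0 then 1 else 0))) ?I"
          by (intro has_integral_sum has_integral_mult_right has_integral_e) auto
        also have "(\<Sum>n\<in>{- int N..int N}. of_real (c n) * e (of_int n * x) * (if n + k = 0 then 1 else 0))
            = (\<Sum>n\<in>{- int N..int N}. if n = - k then of_real (c n) * e (of_int n * x) else 0)"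
          by (intro sum.cong) auto
        also have "- k \<in> {- int N..int N}"
          using N by (auto simp: nat_le_iff)
        hence "(\<Sum>n\<in>{- int N..int N}. if n = - k then of_real (c n) * e (of_int n * x) else 0) = v"
          by (subst sum.delta) (simp_all add: v_def)
        finally show ?thesis by (simp add: sum_distrib_right eq integral_unique)
      qed
      thus "(\<lambda>N. integral ?I (\<lambda>y. (\<Sum>n\<in>{- int N..int N}. tB n (of_real y)) * e (of_int k * y))) \<longlonglongrightarrow> v"
        by (intro tendsto_eventually eventually_sequentiallyI)
    qed
    ultimately have "((\<lambda>y. FA (of_real y) * e (of_int k * y) - FB (of_real y) * e (of_int k * y)) has_integral v - v) ?I"
      by (rule has_integral_diff)
    thus "((\<lambda>y. f y * e (of_int k * y)) has_integral 0) ?I"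
      by (simp add: f_def left_diff_distrib)
  qed
  hence FAB: "FA 0 = FB 0" by (simp add: f_def)
  have "tA n 0 = of_real (exp (- pi * \<tau> * (x + of_int n) ^ 2))" for n
    by (simp add: tA_def exp_of_real[symmetric])
  moreover have "tB n 0 = of_real (exp (- pi * of_int n ^ 2 / \<tau>) / sqrt \<tau>) * e (of_int n * x)" for n
    by (simp add: tB_def c_def e_def mult_ac)
  ultimately show ?thesis
    using GA(1)[where z = 0] GB(1)[where z = 0] FAB by (auto simp: FA_def FB_def)
qed

section \<open>Theta series and their inversion\<close>

lemma even_has_sum_imp_sums:
  fixes g :: "int \<Rightarrow> complex"
  assumes S: "(g has_sum S) UNIV" and even: "\<And>m. g (- m) = g m" and g0: "g 0 = 0"
  shows "(\<lambda>n. g (int (Suc n))) sums (S / 2)"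
proof -
  have "g summable_on {0<..}"
    using S has_sum_imp_summable summable_on_subset_banach by blast
  then obtain P where P: "(g has_sum P) {0<..}" by (auto simp: summable_on_def)
  have "(g has_sum P) {..<0}"
    using P by (subst has_sum_reindex_bij_betw[of uminus "{0<..}", symmetric])
               (auto simp: even intro!: bij_betwI[of _ _ _ uminus])
  hence "(g has_sum (P + P)) ({0<..} \<union> {..<0})"
    by (intro has_sum_Un_disjoint P) auto
  hence "(g has_sum (P + P)) UNIV"
    by (rule has_sum_cong_neutral[THEN iffD1, rotated -1]) (auto simp: g0 neq_iff)
  hence "P + P = S" using S by (rule has_sum_unique)
  hence P_eq: "P = S / 2" by auto
  have "((\<lambda>n. g (int (Suc n))) has_sum P) UNIV"
    using P by (subst has_sum_reindex_bij_betw[of "\<lambda>n. int (Suc n)" UNIV "{0<..}"])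
               (auto intro!: bij_betwI[of _ _ _ "\<lambda>m. nat m - 1"])
  thus ?thesis unfolding P_eq by (rule has_sum_imp_sums)
qed

text \<open>
  Poisson summation is applied separately in every residue class; this puts the classes together.
\<close>
lemma has_sum_int_residue_classes:
  fixes g :: "int \<Rightarrow> complex"
  assumes M: "M > 0"
    and S: "\<And>r. r < M \<Longrightarrow> ((\<lambda>n::int. g (int M * n + int r)) has_sum S r) UNIV"
  shows "(g has_sum (\<Sum>r<M. S r)) UNIV"
proof -
  have "(g has_sum S r) {m. m mod int M = int r}" if r: "r < M" for r
  proof -
    have "bij_betw (\<lambda>n. int M * n + int r) UNIV {m. m mod int M = int r}"
    proof (rule bij_betwI[of _ _ _ "\<lambda>m. m div int M"])
      fix y assume "y \<in> {m. m mod int M = int r}"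
      thus "int M * (y div int M) + int r = y"
        using mult_div_mod_eq[of "int M" y] by simp
    qed (use r in auto)
    from has_sum_reindex_bij_betw[OF this, of g] S[OF r] show ?thesis by simp
  qed
  hence "(g has_sum (\<Sum>r<K. S r)) (\<Union>r<K. {m. m mod int M = int r})" if "K \<le> M" for K
    using that
  proof (induction K)
    case (Suc K)
    hence "(g has_sum ((\<Sum>r<K. S r) + S K)) ((\<Union>r<K. {m. m mod int M = int r}) \<union> {m. m mod int M = int K})"
      by (intro has_sum_Un_disjoint) auto
    thus ?case by (simp add: lessThan_Suc Un_commute add.commute)
  qed simp
  from this[of M] have "(g has_sum (\<Sum>r<M. S r)) (\<Union>r<M. {m. m mod int M = int r})" by simp
  moreover have "(\<Union>r<M. {m. m mod int M = int r}) = UNIV"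
  proof -
    have "m \<in> (\<Union>r<M. {m. m mod int M = int r})" for m
      using M by (intro UN_I[of "nat (m mod int M)"]) (auto simp: nat_less_iff)
    thus ?thesis by (intro equalityI subset_UNIV subsetI)
  qed
  ultimately show ?thesis by simp
qed

lemma has_sum_finite_sum:
  fixes g :: "'i \<Rightarrow> 'a \<Rightarrow> complex"
  assumes "finite I" "\<And>i. i \<in> I \<Longrightarrow> (g i has_sum S i) A"
  shows "((\<lambda>x. \<Sum>i\<in>I. g i x) has_sum (\<Sum>i\<in>I. S i)) A"
  using assms by (induction I rule: finite_induct) (auto intro!: has_sum_add)

text \<open>
  The sum over positive \<open>n\<close> only. For even \<open>f\<close> with \<open>f 0 = 0\<close> it is half of the sum over the integers.
\<close>
definition theta :: "nat \<Rightarrow> (int \<Rightarrow> complex) \<Rightarrow> real \<Rightarrow> complex" where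
  "theta M f t = (\<Sum>n. f (int (Suc n)) * of_real (exp (- pi * real (Suc n) ^ 2 * t / real M)))"

text \<open>
  For \<open>m = M n + r\<close> the Gaussian \<open>exp (- \<pi> m\<^sup>2 t / M)\<close> is \<open>exp (- \<pi> \<tau> (n + r / M)\<^sup>2)\<close> with \<open>\<tau> = M t\<close>.
  Poisson summation at \<open>x = r / M\<close>, weighted by \<open>f r\<close> and summed over \<open>r\<close>, produces the finite Fourier
  transform of \<open>f\<close> on the dual side.
\<close>
lemma theta_inversion:
  fixes f g :: "int \<Rightarrow> complex" and t :: real
  assumes M: "M > 0" and t: "t > 0"
    and periodic: "\<And>m. f (m + int M) = f m"
    and f: "\<And>m. f (- m) = f m" "f 0 = 0"
    and g: "\<And>m. g (- m) = g m" "g 0 = 0"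
    and fourier: "\<And>r. fourier M f r = c * g r"
  shows "theta M f t = c / of_real (sqrt (real M * t)) * theta M g (1 / t)"
proof -
  define \<tau> where "\<tau> = real M * t"
  have \<tau>: "\<tau> > 0" using M t by (simp add: \<tau>_def)
  have periodic': "f (int M * n + m) = f m" for n m
  proof (induction n rule: int_induct[where k = 0])
    case (step1 n) thus ?case using periodic[of "int M * n + m"] by (simp add: algebra_simps)
  next
    case (step2 n) thus ?case using periodic[of "int M * (n - 1) + m"] by (simp add: algebra_simps)
  qed simp
  define P where "P r S \<longleftrightarrow>
    ((\<lambda>n::int. of_real (exp (- pi * \<tau> * (real r / real M + of_int n) ^ 2))) has_sum S) UNIV \<and>
    ((\<lambda>n::int. of_real (exp (- pi * of_int n ^ 2 / \<tau>) / sqrt \<tau>) * e (of_int n * (real r / real M))) has_sum S) UNIV"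
    for r :: nat and S
  have "\<forall>r. \<exists>S. P r S"
    unfolding P_def by (intro allI poisson_gaussian \<tau>)
  then obtain S where "\<forall>r. P r (S r)" by (rule choice[THEN exE])
  hence
    S1: "\<And>r. ((\<lambda>n::int. of_real (exp (- pi * \<tau> * (real r / real M + of_int n) ^ 2))) has_sum S r) UNIV" and
    S2: "\<And>r. ((\<lambda>n::int. of_real (exp (- pi * of_int n ^ 2 / \<tau>) / sqrt \<tau>) * e (of_int n * (real r / real M))) has_sum S r) UNIV"
    by (simp_all only: P_def)
  define A where "A = (\<Sum>r<M. f (int r) * S r)"
  define F where "F m = f m * of_real (exp (- pi * of_int m ^ 2 * t / real M))" for m :: int
  have "(F has_sum A) UNIV" unfolding A_def
  proof (rule has_sum_int_residue_classes[OF M])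
    fix r
    have "F (int M * n + int r) = f (int r) * of_real (exp (- pi * \<tau> * (real r / real M + of_int n) ^ 2))" for n
    proof -
      have "- pi * of_int (int M * n + int r) ^ 2 * t / real M = - pi * \<tau> * (real r / real M + of_int n) ^ 2"
        using M by (simp add: \<tau>_def field_simps power2_eq_square)
      thus ?thesis by (simp only: F_def periodic')
    qed
    thus "((\<lambda>n. F (int M * n + int r)) has_sum f (int r) * S r) UNIV"
      using has_sum_cmult_right[OF S1] by simp
  qed
  from even_has_sum_imp_sums[OF this]
  have 1: "theta M f t = A / 2"
    unfolding theta_def F_def using f by (simp add: sums_iff)
  define G where "G m = c / of_real (sqrt \<tau>) * (g m * of_real (exp (- pi * of_int m ^ 2 / \<tau>)))" for m :: int
  have "((\<lambda>n. \<Sum>r<M. f (int r) * (of_real (exp (- pi * of_int n ^ 2 / \<tau>) / sqrt \<tau>) * e (of_int n * (real r / real M))))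
      has_sum A) UNIV"
    unfolding A_def by (intro has_sum_finite_sum has_sum_cmult_right S2) auto
  also have "(\<lambda>n. \<Sum>r<M. f (int r) * (of_real (exp (- pi * of_int n ^ 2 / \<tau>) / sqrt \<tau>) * e (of_int n * (real r / real M)))) = G"
  proof
    fix n
    have "G n = of_real (exp (- pi * of_int n ^ 2 / \<tau>) / sqrt \<tau>) * fourier M f n"
      by (simp add: G_def fourier)
    also have "\<dots> = (\<Sum>r<M. f (int r) * (of_real (exp (- pi * of_int n ^ 2 / \<tau>) / sqrt \<tau>) * e (of_int n * (real r / real M))))"
      unfolding fourier_def sum_distrib_left by (intro sum.cong) (simp_all add: mult_ac)
    finally show "(\<Sum>r<M. f (int r) * (of_real (exp (- pi * of_int n ^ 2 / \<tau>) / sqrt \<tau>) * e (of_int n * (real r / real M)))) = G n" ..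
  qed
  finally have "(G has_sum A) UNIV" .
  hence "(\<lambda>n. G (int (Suc n))) sums (A / 2)"
    by (rule even_has_sum_imp_sums) (simp_all add: G_def g)
  hence "(\<Sum>n. G (int (Suc n))) = A / 2" by (simp add: sums_iff)
  have "c / of_real (sqrt \<tau>) * theta M g (1 / t) = A / 2"
  proof (cases "c = 0")
    case True
    have "A / 2 = 0" using \<open>(\<Sum>n. G (int (Suc n))) = A / 2\<close> by (simp add: G_def True)
    thus ?thesis by (simp add: True)
  next
    case False
    have "c / of_real (sqrt \<tau>) \<noteq> 0" using False \<tau> by simp
    hence "A / 2 = c / of_real (sqrt \<tau>) * (A / 2 / (c / of_real (sqrt \<tau>)))"
      by simp
    with \<open>(\<lambda>n. G (int (Suc n))) sums (A / 2)\<close>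
    have "(\<lambda>n. c / of_real (sqrt \<tau>) * (g (int (Suc n)) * of_real (exp (- pi * of_int (int (Suc n)) ^ 2 / \<tau>))))
        sums (c / of_real (sqrt \<tau>) * (A / 2 / (c / of_real (sqrt \<tau>))))"
      by (simp only: G_def)
    hence "(\<lambda>n. g (int (Suc n)) * of_real (exp (- pi * of_int (int (Suc n)) ^ 2 / \<tau>)))
        sums (A / 2 / (c / of_real (sqrt \<tau>)))"
      by (rule sums_mult_iff[OF \<open>c / of_real (sqrt \<tau>) \<noteq> 0\<close>, THEN iffD1])
    moreover have "- pi * of_int (int (Suc n)) ^ 2 / \<tau> = - pi * real (Suc n) ^ 2 * (1 / t) / real M" for n
      by (simp add: \<tau>_def field_simps)
    ultimately have "theta M g (1 / t) = A / 2 / (c / of_real (sqrt \<tau>))"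
      unfolding theta_def by (simp add: sums_iff)
    thus ?thesis using \<open>c / of_real (sqrt \<tau>) \<noteq> 0\<close> by simp
  qed
  thus ?thesis by (simp add: 1 \<tau>_def)
qed

section \<open>Mellin transforms of theta series\<close>

lemma absolutely_integrable_UNIV_imp_lborel:
  fixes f :: "real \<Rightarrow> complex"
  assumes "f absolutely_integrable_on UNIV" "f \<in> borel_measurable borel"
  shows "integrable lborel f" "(LBINT x. f x) = integral UNIV f"
proof -
  have "integrable lebesgue f"
    using assms(1) by (simp add: set_integrable_def)
  thus "integrable lborel f"
    using assms(2) by (subst (asm) integrable_completion) auto
  from integral_unique[OF has_integral_integral_lborel[OF this]]
  show "(LBINT x. f x) = integral UNIV f" by simp
qed

text \<open>
  Euler's integral for the Gamma function after the substitution \<open>t = c exp x\<close>.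
\<close>
lemma Gamma_integral_exponential:
  fixes c :: real and w :: complex
  assumes c: "c > 0" and w: "Re w > 0"
  shows "integrable lborel (\<lambda>x. of_real (exp (- c * exp x)) * exp (w * of_real x))" (is ?A)
    and "(LBINT x. of_real (exp (- c * exp x)) * exp (w * of_real x)) = of_real c powr (- w) * Gamma w" (is ?B)
proof -
  let ?f = "\<lambda>t. complex_of_real t powr (w - 1) / of_real (exp t)"
  let ?g = "\<lambda>x. of_real (exp (- c * exp x)) * exp (w * of_real x)"
  have image: "(\<lambda>x. c * exp x) ` UNIV = {0<..}"
  proof (intro equalityI subsetI)
    fix y :: real assume "y \<in> {0<..}"
    hence "y = c * exp (ln (y / c))" using c by simp
    thus "y \<in> (\<lambda>x. c * exp x) ` UNIV" by blast
  qed (use c in auto)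
  have "?f absolutely_integrable_on (\<lambda>x. c * exp x) ` UNIV \<and> integral ((\<lambda>x. c * exp x) ` UNIV) ?f = Gamma w"
    unfolding image using absolutely_integrable_Gamma_integral'[OF w] Gamma_integral_complex'[OF w]
    by (simp add: integral_unique)
  hence "(\<lambda>x. \<bar>c * exp x\<bar> *\<^sub>R ?f (c * exp x)) absolutely_integrable_on UNIV
      \<and> integral UNIV (\<lambda>x. \<bar>c * exp x\<bar> *\<^sub>R ?f (c * exp x)) = Gamma w"
    by (subst has_absolute_integral_change_of_variables_real)
       (use c in \<open>auto intro!: derivative_eq_intros inj_onI\<close>)
  also have "(\<lambda>x. \<bar>c * exp x\<bar> *\<^sub>R ?f (c * exp x)) = (\<lambda>x. of_real c powr w * ?g x)"
  proof
    fix x :: real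
    have "complex_of_real (c * exp x) powr w = exp (w * of_real (ln c + x))"
      using c by (simp add: powr_def ln_mult Ln_of_real del: of_real_mult)
    also have "\<dots> = of_real c powr w * exp (w * of_real x)"
      using c by (simp add: powr_def Ln_of_real ring_distribs exp_add)
    finally have "complex_of_real (c * exp x) powr w = of_real c powr w * exp (w * of_real x)" .
    moreover have "of_real (c * exp x) * complex_of_real (c * exp x) powr (w - 1) = complex_of_real (c * exp x) powr w"
      using c by (simp add: powr_diff)
    moreover have "\<bar>c * exp x\<bar> *\<^sub>R ?f (c * exp x)
        = (of_real (c * exp x) * complex_of_real (c * exp x) powr (w - 1)) * of_real (exp (- c * exp x))"
      using c by (simp add: scaleR_conv_of_real exp_minus field_simps)
    ultimately show "\<bar>c * exp x\<bar> *\<^sub>R ?f (c * exp x) = of_real c powr w * ?g x"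
      by (simp only: mult_ac)
  qed
  finally have *: "(\<lambda>x. of_real c powr w * ?g x) absolutely_integrable_on UNIV"
    "integral UNIV (\<lambda>x. of_real c powr w * ?g x) = Gamma w" by auto
  have meas: "(\<lambda>x. of_real c powr w * ?g x) \<in> borel_measurable borel"
    by (intro borel_measurable_continuous_onI continuous_intros)
  note I = absolutely_integrable_UNIV_imp_lborel[OF *(1) meas, unfolded *(2)]
  have ne: "complex_of_real c powr w \<noteq> 0" using c by simp
  from integrable_mult_right[OF I(1), of "inverse (of_real c powr w)"] ne
  show ?A by (simp add: mult.assoc[symmetric])
  show ?B using I(2) ne by (simp add: powr_minus field_simps)
qed

lemma norm_Gamma_integral_exponential:
  fixes c :: real and w :: complex
  assumes "c > 0" "Re w > 0"
  shows "(LBINT x. norm (of_real (exp (- c * exp x)) * exp (w * of_real x)))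
     = c powr (- Re w) * Gamma (Re w)"
proof -
  have "complex_of_real (LBINT x. norm (of_real (exp (- c * exp x)) * exp (w * of_real x)))
      = (LBINT x. of_real (exp (- c * exp x)) * exp (of_real (Re w) * of_real x))"
    by (subst integral_complex_of_real[symmetric])
       (simp add: norm_mult exp_of_real[symmetric])
  also have "\<dots> = of_real c powr (- of_real (Re w)) * Gamma (of_real (Re w))"
    using assms by (intro Gamma_integral_exponential) auto
  also have "\<dots> = of_real (c powr (- Re w) * Gamma (Re w))"
    using assms by (simp add: Gamma_complex_of_real powr_of_real[symmetric])
  finally show ?thesis by (simp only: of_real_eq_iff)
qed

text \<open>
  Integration term by term. The \<open>n\<close>-th term contributes \<open>c n powr (- s / 2) Gamma (s / 2)\<close>, which is
  \<open>n powr (- s)\<close> up to the Gamma factor of the completed \<open>L\<close>-function, and absolute convergence for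
  \<open>Re s > 1\<close> justifies the interchange. The same estimate gives integrability of the theta series against
  \<open>exp (\<sigma> x)\<close> for all real \<open>\<sigma> > 1/2\<close>.
\<close>
lemma theta_mellin:
  fixes f :: "int \<Rightarrow> complex" and s :: complex
  assumes M: "M > 0" and B: "\<And>m. norm (f m) \<le> B" and s: "Re s > 1"
  shows "integrable lborel (\<lambda>x. theta M f (exp x) * exp (s / 2 * of_real x))" (is ?A)
    and "(\<lambda>n. f (int (Suc n)) * of_nat (Suc n) powr (- s)) sums
       ((LBINT x. theta M f (exp x) * exp (s / 2 * of_real x)) / (of_real (real M / pi) powr (s / 2) * Gamma (s / 2)))" (is ?B)
proof -
  define c where "c n = pi * real (Suc n) ^ 2 / real M" for n
  define F where "F n x = f (int (Suc n)) * (of_real (exp (- c n * exp x)) * exp (s / 2 * of_real x))" for n x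
  have c: "c n > 0" for n using M by (simp add: c_def)
  have s2: "Re (s / 2) > 0" using s by simp
  have B0: "B \<ge> 0" using B[of 0] norm_ge_zero order_trans by blast
  note GI = Gamma_integral_exponential[OF c s2]
  have int: "integrable lborel (F n)" for n
    unfolding F_def by (intro integrable_mult_right GI)
  have pointwise: "summable (\<lambda>n. norm (f (int (Suc n)) * of_real (exp (- c n * exp x))))" for x
  proof (rule summable_comparison_test'[where N = 0])
    define q where "q = exp (- (pi * exp x / real M))"
    show "summable (\<lambda>n. B * q ^ n)"
      using M by (intro summable_mult summable_geometric) (auto simp: q_def)
    fix n :: nat
    have "real n \<le> real (Suc n) ^ 2" by (simp add: power2_eq_square algebra_simps)
    hence "pi * exp x / real M * real n \<le> pi * exp x / real M * real (Suc n) ^ 2"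
      using M by (intro mult_left_mono) auto
    hence "exp (- c n * exp x) \<le> exp (- (pi * exp x / real M * real n))"
      by (simp add: c_def mult_ac)
    also have "\<dots> = q ^ n" by (simp add: q_def exp_of_nat_mult[symmetric] mult_ac)
    finally show "norm (norm (f (int (Suc n)) * of_real (exp (- c n * exp x)))) \<le> B * q ^ n"
      using B B0 by (simp add: norm_mult mult_mono)
  qed
  have summable_x: "summable (\<lambda>n. norm (F n x))" for x
    using summable_mult2[OF pointwise[of x], of "norm (exp (s / 2 * of_real x))"]
    by (simp add: F_def norm_mult mult_ac)
  have summable_int: "summable (\<lambda>n. LBINT x. norm (F n x))"
  proof (rule summable_comparison_test'[where N = 0])
    let ?K = "B * ((pi / real M) powr (- Re (s / 2)) * Gamma (Re (s / 2)))"
    have "summable (\<lambda>n. real (Suc n) powr (- Re s))"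
      using s by (subst summable_Suc_iff) (simp add: summable_real_powr_iff)
    thus "summable (\<lambda>n. ?K * real (Suc n) powr (- Re s))" by (rule summable_mult)
    fix n :: nat
    have cn: "c n powr (- Re (s / 2)) = (pi / real M) powr (- Re (s / 2)) * real (Suc n) powr (- Re s)"
    proof -
      have "c n = pi / real M * real (Suc n) powr 2" by (simp add: c_def powr_numeral)
      thus ?thesis using M by (simp only:) (subst powr_mult, auto simp: powr_powr simp del: powr_numeral of_nat_Suc)
    qed
    have "(LBINT x. norm (F n x)) = norm (f (int (Suc n))) * (c n powr (- Re (s / 2)) * Gamma (Re (s / 2)))"
      unfolding F_def norm_mult[of "f _"]
      by (simp only: integral_mult_right_zero norm_Gamma_integral_exponential[OF c s2])
    also have "\<dots> \<le> B * (c n powr (- Re (s / 2)) * Gamma (Re (s / 2)))"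
      using s2 by (intro mult_right_mono B mult_nonneg_nonneg) (auto intro: less_imp_le Gamma_real_pos)
    also have "\<dots> = ?K * real (Suc n) powr (- Re s)" unfolding cn by (simp only: mult_ac)
    finally show "norm (LBINT x. norm (F n x)) \<le> ?K * real (Suc n) powr (- Re s)"
      by simp
  qed
  have sum_F: "(\<Sum>n. F n x) = theta M f (exp x) * exp (s / 2 * of_real x)" for x
  proof -
    have "(\<Sum>n. F n x) = (\<Sum>n. f (int (Suc n)) * of_real (exp (- c n * exp x)) * exp (s / 2 * of_real x))"
      by (simp add: F_def mult.assoc)
    also have "\<dots> = (\<Sum>n. f (int (Suc n)) * of_real (exp (- c n * exp x))) * exp (s / 2 * of_real x)"
      by (rule suminf_mult2[symmetric]) (rule summable_norm_cancel[OF pointwise])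
    also have "(\<Sum>n. f (int (Suc n)) * of_real (exp (- c n * exp x))) = theta M f (exp x)"
      by (simp add: theta_def c_def)
    finally show ?thesis .
  qed
  from integrable_suminf[OF int AE_I2[OF summable_x] summable_int] show ?A
    unfolding sum_F .
  have "(\<lambda>n. LBINT x. F n x) sums (LBINT x. theta M f (exp x) * exp (s / 2 * of_real x))"
    using sums_integral[OF int AE_I2[OF summable_x] summable_int] unfolding sum_F .
  also have "(\<lambda>n. LBINT x. F n x) = (\<lambda>n. (of_real (real M / pi) powr (s / 2) * Gamma (s / 2)) * (f (int (Suc n)) * of_nat (Suc n) powr (- s)))"
  proof
    fix n
    have "of_real (c n) powr (- (s / 2)) = of_real (real M / pi) powr (s / 2) * of_nat (Suc n) powr (- s)"
    proof -
      have "ln (c n) = - ln (real M / pi) + 2 * ln (real (Suc n))"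
        using M by (simp add: c_def ln_mult ln_div ln_realpow)
      hence ln_c: "complex_of_real (ln (c n)) = - of_real (ln (real M / pi)) + 2 * of_real (ln (real (Suc n)))"
        by (simp only: of_real_add of_real_minus of_real_mult of_real_numeral)
      have "- (s / 2) * of_real (ln (c n)) = s / 2 * of_real (ln (real M / pi)) + - s * of_real (ln (real (Suc n)))"
        unfolding ln_c by (simp only: ring_distribs) simp
      hence "exp (- (s / 2) * of_real (ln (c n))) = exp (s / 2 * of_real (ln (real M / pi))) * exp (- s * of_real (ln (real (Suc n))))"
        by (simp only: exp_add)
      moreover have "Ln (of_nat (Suc n)) = of_real (ln (real (Suc n)))"
        using Ln_of_real[of "real (Suc n)"] by (simp del: of_nat_Suc)
      moreover have "of_nat (Suc n) \<noteq> (0::complex)" by (simp del: of_nat_Suc)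
      ultimately show ?thesis
        using c[of n] M Ln_of_real[of "c n"] Ln_of_real[of "real M / pi"]
        by (simp add: powr_def del: of_nat_Suc of_real_divide)
    qed
    thus "(LBINT x. F n x) = (of_real (real M / pi) powr (s / 2) * Gamma (s / 2)) * (f (int (Suc n)) * of_nat (Suc n) powr (- s))"
      unfolding F_def integral_mult_right_zero GI(2) by (simp only: mult_ac)
  qed
  finally have *: "(\<lambda>n. (of_real (real M / pi) powr (s / 2) * Gamma (s / 2)) * (f (int (Suc n)) * of_nat (Suc n) powr (- s)))
      sums (LBINT x. theta M f (exp x) * exp (s / 2 * of_real x))" .
  have "of_real (real M / pi) powr (s / 2) * Gamma (s / 2) \<noteq> 0"
  proof -
    have "s / 2 \<notin> \<int>\<^sub>\<le>\<^sub>0" using s2 by (auto elim!: nonpos_Ints_cases)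
    thus ?thesis using M by (simp add: Gamma_eq_zero_iff)
  qed
  from sums_divide[OF *, of "of_real (real M / pi) powr (s / 2) * Gamma (s / 2)"] this
  show ?B by (simp del: of_nat_Suc)
qed

text \<open>
  Expanding \<open>exp (w x)\<close> and integrating term by term gives a power series in \<open>w\<close>; its absolute convergence
  for every \<open>w\<close> is integrability of \<open>G\<close> against \<open>exp (\<bar>w\<bar> \<bar>x\<bar>)\<close>.
\<close>
lemma holomorphic_two_sided_laplace:
  fixes G :: "real \<Rightarrow> complex"
  assumes int: "\<And>K. integrable lborel (\<lambda>x. norm (G x) * exp (K * \<bar>x\<bar>))"
    and meas: "G \<in> borel_measurable borel"
  shows "(\<lambda>w. LBINT x. G x * exp (w * of_real x)) holomorphic_on UNIV"
proof -
  define a where "a n = (LBINT x. G x * of_real (x ^ n / fact n))" for n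
  have sums: "(\<lambda>n. a n * w ^ n) sums (LBINT x. G x * exp (w * of_real x))" for w
  proof -
    define F where "F n x = G x * (w * of_real x) ^ n /\<^sub>R fact n" for n x
    have F_meas: "F n \<in> borel_measurable lborel" for n
      unfolding F_def using meas by measurable
    have norm_F: "norm (F n x) = norm (G x) * ((norm w * \<bar>x\<bar>) ^ n /\<^sub>R fact n)" for n x
      by (simp add: F_def norm_mult norm_power divide_inverse)
    have norm_sums: "(\<lambda>n. norm (F n x)) sums (norm (G x) * exp (norm w * \<bar>x\<bar>))" for x
      unfolding norm_F by (intro sums_mult exp_converges)
    have partial_le: "(\<Sum>i\<in>I. norm (F i x)) \<le> norm (G x) * exp (norm w * \<bar>x\<bar>)" if "finite I" for I x
      using sum_le_suminf[OF sums_summable[OF norm_sums[of x]] that] norm_sums[of x]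
      by (simp add: sums_iff)
    have F_int: "integrable lborel (F n)" for n
    proof (rule Bochner_Integration.integrable_bound[OF int[of "norm w"] F_meas])
      show "AE x in lborel. norm (F n x) \<le> norm (norm (G x) * exp (norm w * \<bar>x\<bar>))"
      proof (rule AE_I2)
        fix x
        have "norm (F n x) = (\<Sum>i\<in>{n}. norm (F i x))" by simp
        also have "\<dots> \<le> norm (G x) * exp (norm w * \<bar>x\<bar>)"
          by (rule partial_le) simp
        finally show "norm (F n x) \<le> norm (norm (G x) * exp (norm w * \<bar>x\<bar>))" by simp
      qed
    qed
    have summable_int: "summable (\<lambda>n. LBINT x. norm (F n x))"
    proof (rule summableI_nonneg_bounded)
      fix n
      have "(\<Sum>i<n. LBINT x. norm (F i x)) = (LBINT x. \<Sum>i<n. norm (F i x))"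
        using F_int by (intro Bochner_Integration.integral_sum[symmetric] integrable_norm)
      also have "\<dots> \<le> (LBINT x. norm (G x) * exp (norm w * \<bar>x\<bar>))"
        using F_int by (intro integral_mono int partial_le Bochner_Integration.integrable_sum integrable_norm) auto
      finally show "(\<Sum>i<n. LBINT x. norm (F i x)) \<le> (LBINT x. norm (G x) * exp (norm w * \<bar>x\<bar>))" .
    qed simp
    have "(\<lambda>n. LBINT x. F n x) sums (LBINT x. \<Sum>n. F n x)"
      by (rule sums_integral[OF F_int AE_I2 summable_int]) (use norm_sums sums_summable in blast)
    also have "(\<lambda>x. \<Sum>n. F n x) = (\<lambda>x. G x * exp (w * of_real x))"
    proof
      fix x
      have "(\<lambda>n. F n x) sums (G x * exp (w * of_real x))"
        unfolding F_def using sums_mult[OF exp_converges[of "w * of_real x"], of "G x"]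
        by (simp add: scaleR_conv_of_real mult_ac)
      thus "(\<Sum>n. F n x) = G x * exp (w * of_real x)" by (simp add: sums_iff)
    qed
    also have "(\<lambda>n. LBINT x. F n x) = (\<lambda>n. a n * w ^ n)"
    proof
      fix n
      have "F n x = G x * of_real (x ^ n / fact n) * w ^ n" for x
        by (simp add: F_def scaleR_conv_of_real power_mult_distrib field_simps)
      thus "(LBINT x. F n x) = a n * w ^ n" by (simp only: a_def integral_mult_left_zero)
    qed
    finally show ?thesis .
  qed
  have "(\<lambda>w. LBINT x. G x * exp (w * of_real x)) holomorphic_on ball 0 (real r)" for r
    by (rule power_series_holomorphic[where a = a]) (use sums in simp)
  hence "(\<lambda>w. LBINT x. G x * exp (w * of_real x)) holomorphic_on (\<Union>r\<in>UNIV. ball 0 (real r))"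
    by (intro holomorphic_on_UN_open) auto
  moreover have "(\<Union>r\<in>UNIV. ball (0::complex) (real r)) = UNIV"
    using reals_Archimedean2 by auto
  ultimately show ?thesis by simp
qed

text \<open>
  The Mellin transform of the theta series in the variable \<open>x = ln t\<close>, with which the inversion
  \<open>t \<mapsto> 1/t\<close> is a reflection of the line.
\<close>
definition mellin_theta :: "nat \<Rightarrow> (int \<Rightarrow> complex) \<Rightarrow> complex \<Rightarrow> complex" where
  "mellin_theta M f s = (LBINT x. theta M f (exp x) * exp (s / 2 * of_real x))"

lemma mellin_theta_functional_equation:
  fixes f g :: "int \<Rightarrow> complex"
  assumes inv: "\<And>x. theta M f (exp x) = \<omega> * exp (- of_real x / 2) * theta M g (exp (- x))"
  shows "mellin_theta M f s = \<omega> * mellin_theta M g (1 - s)"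
proof -
  have "mellin_theta M f s = (LBINT x. \<omega> * (theta M g (exp (0 + - 1 * x)) * exp ((1 - s) / 2 * of_real (0 + - 1 * x))))"
    unfolding mellin_theta_def
  proof (intro Bochner_Integration.integral_cong refl)
    fix x :: real
    have "exp (- complex_of_real x / 2) * exp (s / 2 * of_real x) = exp ((1 - s) / 2 * of_real (0 + - 1 * x))"
      unfolding exp_add[symmetric] by (simp add: field_simps)
    thus "theta M f (exp x) * exp (s / 2 * of_real x)
        = \<omega> * (theta M g (exp (0 + - 1 * x)) * exp ((1 - s) / 2 * of_real (0 + - 1 * x)))"
      by (simp add: inv mult_ac)
  qed
  also have "\<dots> = \<omega> * mellin_theta M g (1 - s)"
    unfolding mellin_theta_def
    using lborel_integral_real_affine[of "- 1" "\<lambda>x. theta M g (exp x) * exp ((1 - s) / 2 * of_real x)" 0]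
    by simp
  finally show ?thesis .
qed

text \<open>
  Decay at both ends needs no separate estimate of the theta series. Convergence of the integral to the
  right of the critical strip controls \<open>x \<rightarrow> \<infinity>\<close>, for \<open>g\<close> as well as for \<open>f\<close>, and the inversion formula
  carries the bound for \<open>g\<close> at \<open>\<infinity>\<close> to one for \<open>f\<close> at \<open>-\<infinity>\<close>.
\<close>
lemma holomorphic_mellin_theta:
  fixes f g :: "int \<Rightarrow> complex"
  assumes M: "M > 0" and B: "\<And>m. norm (f m) \<le> B" "\<And>m. norm (g m) \<le> B'"
    and inv: "\<And>x. theta M f (exp x) = \<omega> * exp (- of_real x / 2) * theta M g (exp (- x))"
  shows "mellin_theta M f holomorphic_on UNIV"
proof -
  define G where "G x = theta M f (exp x)" for x
  have meas: "G \<in> borel_measurable borel"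
  proof -
    have "(\<lambda>x. theta M f (exp x) * exp (2 / 2 * of_real x)) \<in> borel_measurable lborel"
      by (intro borel_measurable_integrable theta_mellin[OF M B(1)]) auto
    hence "(\<lambda>x. theta M f (exp x) * exp (2 / 2 * of_real x)) \<in> borel_measurable borel"
      by simp
    hence "(\<lambda>x. theta M f (exp x) * exp (2 / 2 * of_real x) * exp (- of_real x)) \<in> borel_measurable borel"
    proof (rule borel_measurable_times)
      show "(\<lambda>x. exp (- complex_of_real x)) \<in> borel_measurable borel"
        by (intro borel_measurable_continuous_onI continuous_intros)
    qed
    also have "(\<lambda>x. theta M f (exp x) * exp (2 / 2 * of_real x) * exp (- of_real x)) = G"
      by (simp add: fun_eq_iff G_def mult.assoc exp_add[symmetric])
    finally show ?thesis .
  qed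
  \<comment> \<open>The exponent \<open>K\<close> corresponds to \<open>s = 2K\<close> here and to \<open>s = 2K + 1\<close> for \<open>g\<close> below, both inside the
    half-plane \<open>Re s > 1\<close>.\<close>
  have right: "integrable lborel (\<lambda>x. norm (G x) * exp (K * x))" if K: "K \<ge> 1" for K
  proof -
    have "integrable lborel (\<lambda>x. theta M f (exp x) * exp (of_real (2 * K) / 2 * of_real x))"
      by (rule theta_mellin[OF M B(1)]) (use K in auto)
    from integrable_norm[OF this] show ?thesis
      by (simp add: G_def norm_mult)
  qed
  have left: "integrable lborel (\<lambda>x. norm (G x) * exp (- K * x))" if K: "K \<ge> 1" for K
  proof -
    have "integrable lborel (\<lambda>x. theta M g (exp x) * exp (of_real (2 * K + 1) / 2 * of_real x))"
      by (rule theta_mellin[OF M B(2)]) (use K in auto)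
    hence "integrable lborel (\<lambda>x. theta M g (exp (0 + - 1 * x)) * exp (of_real (2 * K + 1) / 2 * of_real (0 + - 1 * x)))"
      by (subst lborel_integrable_real_affine_iff[of "- 1" "\<lambda>x. theta M g (exp x) * exp (of_real (2 * K + 1) / 2 * of_real x)" 0]) auto
    hence "integrable lborel (\<lambda>x. norm (\<omega> * (theta M g (exp (0 + - 1 * x)) * exp (of_real (2 * K + 1) / 2 * of_real (0 + - 1 * x)))))"
      by (intro integrable_norm integrable_mult_right)
    also have "(\<lambda>x. norm (\<omega> * (theta M g (exp (0 + - 1 * x)) * exp (of_real (2 * K + 1) / 2 * of_real (0 + - 1 * x)))))
        = (\<lambda>x. norm (G x) * exp (- K * x))"
    proof
      fix x :: real
      have "exp (- x / 2) * exp (- K * x) = exp ((2 * K + 1) / 2 * (0 + - 1 * x))"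
        unfolding exp_add[symmetric] by (simp add: field_simps)
      thus "norm (\<omega> * (theta M g (exp (0 + - 1 * x)) * exp (of_real (2 * K + 1) / 2 * of_real (0 + - 1 * x))))
          = norm (G x) * exp (- K * x)"
        by (simp add: G_def inv norm_mult)
    qed
    finally show ?thesis .
  qed
  have int: "integrable lborel (\<lambda>x. norm (G x) * exp (K * \<bar>x\<bar>))" for K
  proof (rule Bochner_Integration.integrable_bound[OF Bochner_Integration.integrable_add[OF right left]])
    let ?K = "max K 1"
    show "?K \<ge> 1" "?K \<ge> 1" by auto
    show "(\<lambda>x. norm (G x) * exp (K * \<bar>x\<bar>)) \<in> borel_measurable lborel"
      using meas by measurable
    show "AE x in lborel. norm (norm (G x) * exp (K * \<bar>x\<bar>))
        \<le> norm (norm (G x) * exp (?K * x) + norm (G x) * exp (- ?K * x))"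
    proof (rule AE_I2)
      fix x :: real
      have "exp (K * \<bar>x\<bar>) \<le> exp (?K * \<bar>x\<bar>)" by (simp add: mult_right_mono)
      also have "\<dots> \<le> exp (?K * x) + exp (- ?K * x)" by (cases "x \<ge> 0") auto
      finally have "norm (G x) * exp (K * \<bar>x\<bar>) \<le> norm (G x) * (exp (?K * x) + exp (- ?K * x))"
        by (rule mult_left_mono) auto
      thus "norm (norm (G x) * exp (K * \<bar>x\<bar>))
          \<le> norm (norm (G x) * exp (?K * x) + norm (G x) * exp (- ?K * x))"
        by (simp add: ring_distribs)
    qed
  qed
  have "((\<lambda>w. LBINT x. G x * exp (w * of_real x)) \<circ> (\<lambda>s. s / 2)) holomorphic_on UNIV"
    by (rule holomorphic_on_compose_gen[OF _ holomorphic_two_sided_laplace[OF int meas]])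
       (auto intro!: holomorphic_intros)
  thus ?thesis by (simp add: o_def mellin_theta_def[abs_def] G_def)
qed

section \<open>L-functions and their functional equations\<close>

text \<open>
  Any entire function that agrees with the Dirichlet series for \<open>Re s > 1\<close> is the continuation of the
  \<open>L\<close>-function. Grouping the series into blocks of length \<open>M\<close> identifies it with the combination of
  Hurwitz zeta functions for \<open>Re s > 1\<close>, the identity theorem extends this to \<open>- {1}\<close>, and at \<open>1\<close> the
  removable singularity is filled in.
\<close>
lemma L_eq_continuation:
  fixes f :: "int \<Rightarrow> complex"
  assumes M: "M > 0" and periodic: "\<And>m. f (m + int M) = f m"
    and E: "E holomorphic_on UNIV"
    and sums: "\<And>s. Re s > 1 \<Longrightarrow> (\<lambda>n. f (int (Suc n)) * of_nat (Suc n) powr (- s)) sums E s"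
  shows "L M f s = E s"
proof (cases "Re s > 1")
  case True
  thus ?thesis using sums[OF True] by (simp add: L_def sums_iff)
next
  case False
  define H where "H z = of_nat M powr (- z) * (\<Sum>r=1..M. f (int r) * hurwitz_zeta z (real r / real M))" for z
  have periodic': "f (int (k * M) + m) = f m" for k m
  proof (induction k)
    case (Suc k)
    thus ?case using periodic[of "int (k * M) + m"] by (simp add: algebra_simps)
  qed simp
  have "H z = E z" if z: "z \<noteq> 1" for z
  proof (rule analytic_continuation_open[of "{z. Re z > 1}" "- {1}" H E])
    show "connected (- {1::complex})" by (simp add: connected_punctured_universe)
    show "{z. Re z > 1} \<noteq> {}" by (auto intro!: exI[of _ 2])
    show "H holomorphic_on - {1}" unfolding H_def[abs_def] using M
      by (intro holomorphic_intros holomorphic_hurwitz_zeta) auto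
    fix z assume "z \<in> {z. Re z > 1}"
    hence z: "Re z > 1" by simp
    have group: "(\<Sum>n\<in>{k * M..<k * M + M}. f (int (Suc n)) * of_nat (Suc n) powr (- z))
        = of_nat M powr (- z) * (\<Sum>r=1..M. f (int r) * of_real (real k + real r / real M) powr (- z))" for k
    proof -
      have "(\<Sum>n\<in>{k * M..<k * M + M}. f (int (Suc n)) * of_nat (Suc n) powr (- z))
          = (\<Sum>r=1..M. f (int (k * M + r)) * of_nat (k * M + r) powr (- z))"
        by (rule sum.reindex_bij_witness[of _ "\<lambda>r. k * M + r - 1" "\<lambda>n. n + 1 - k * M"]) auto
      also have "\<dots> = (\<Sum>r=1..M. of_nat M powr (- z) * (f (int r) * of_real (real k + real r / real M) powr (- z)))"
      proof (rule sum.cong)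
        fix r
        have "complex_of_nat (k * M + r) = of_nat M * of_real (real k + real r / real M)"
          using M by (simp add: field_simps)
        hence "of_nat (k * M + r) powr (- z) = of_nat M powr (- z) * of_real (real k + real r / real M) powr (- z)"
          by (simp only: powr_times_real_left Reals_of_nat complex_Re_of_nat of_nat_0_le_iff)
        thus "f (int (k * M + r)) * of_nat (k * M + r) powr (- z)
          = of_nat M powr (- z) * (f (int r) * of_real (real k + real r / real M) powr (- z))"
          using periodic'[of k "int r"] by (simp add: mult_ac)
      qed simp
      finally show ?thesis by (simp only: sum_distrib_left)
    qed
    have "(\<lambda>k. \<Sum>n\<in>{k * M..<k * M + M}. f (int (Suc n)) * of_nat (Suc n) powr (- z)) sums E z"
      by (rule sums_group[OF sums[OF z] M])
    moreover have "(\<lambda>k. \<Sum>n\<in>{k * M..<k * M + M}. f (int (Suc n)) * of_nat (Suc n) powr (- z)) sums H z"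
      unfolding group H_def using M z
      by (intro sums_mult sums_sum hurwitz_zeta_sums) auto
    ultimately show "H z = E z" by (rule sums_unique2[rotated])
  qed (use z E in \<open>auto simp: open_halfspace_Re_gt intro: holomorphic_on_subset\<close>)
  hence "\<forall>\<^sub>F z in at s. H z = E z"
    using eventually_neq_at_within[of 1 s UNIV] by (auto elim: eventually_mono)
  moreover have "E \<midarrow>s\<rightarrow> E s"
    using holomorphic_on_imp_continuous_on[OF E] by (simp add: continuous_on_def)
  ultimately have "H \<midarrow>s\<rightarrow> E s" by (simp add: tendsto_cong)
  hence "remove_sings H s = E s" by (rule remove_sings_eqI)
  thus ?thesis using False by (simp add: L_def H_def[abs_def])
qed

lemma theta_b_inversion:
  assumes h: "h > 0" "even h" and uv: "2 * int h dvd v * u + 1"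
  shows "theta (4 * h) (b h u) (exp x)
       = omega h u * exp (- of_real x / 2) * theta (4 * h) (b h v) (exp (- x))"
proof -
  have u: "odd u" using uv by (metis dvd_trans dvd_triv_left even_add even_mult_iff odd_one)
  have "theta (4 * h) (b h u) (exp x)
      = C h u / of_real (sqrt (real (4 * h) * exp x)) * theta (4 * h) (b h v) (1 / exp x)"
    by (rule theta_inversion)
       (use h b_periodic[OF h u] fourier_b[OF h uv] in \<open>simp_all add: b_minus b_even\<close>)
  also have "sqrt (exp x) = exp (x / 2)"
    by (rule real_sqrt_unique) (simp_all add: power2_eq_square exp_add[symmetric])
  hence "sqrt (real (4 * h) * exp x) = sqrt (real (4 * h)) * exp (x / 2)"
    by (simp only: real_sqrt_mult)
  also have "1 / exp x = exp (- x)" by (simp add: exp_minus field_simps)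
  also have "C h u / of_real (sqrt (real (4 * h)) * exp (x / 2)) = omega h u * exp (- of_real x / 2)"
    by (simp add: omega_def exp_minus exp_of_real[symmetric] field_simps)
  finally show ?thesis .
qed

text \<open>
  The Mellin transform is the completed \<open>L\<close>-function. Stating this with the entire function \<open>rGamma\<close>
  instead of \<open>1 / Gamma\<close> makes it valid at every \<open>s\<close>.
\<close>
lemma mellin_theta_b:
  assumes h: "h > 0" "even h" and uv: "2 * int h dvd v * u + 1"
  shows holomorphic_mellin_theta_b: "mellin_theta (4 * h) (b h u) holomorphic_on UNIV"
    and mellin_theta_b_functional_equation:
      "mellin_theta (4 * h) (b h u) s = omega h u * mellin_theta (4 * h) (b h v) (1 - s)"
    and L_b: "L (4 * h) (b h u) s = of_real (real (4 * h) / pi) powr (- (s / 2)) * rGamma (s / 2)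
                * mellin_theta (4 * h) (b h u) s"
proof -
  let ?P = "mellin_theta (4 * h) (b h u)"
  have u: "odd u" using uv by (metis dvd_trans dvd_triv_left even_add even_mult_iff odd_one)
  have M: "4 * h > 0" using h by simp
  have bound: "norm (b h w m) \<le> 1" for w m by (simp add: norm_b)
  note inv = theta_b_inversion[OF h uv]
  show hol: "?P holomorphic_on UNIV"
    by (rule holomorphic_mellin_theta[OF M bound bound inv])
  show "?P s = omega h u * mellin_theta (4 * h) (b h v) (1 - s)"
    by (rule mellin_theta_functional_equation[OF inv])
  show "L (4 * h) (b h u) s = of_real (real (4 * h) / pi) powr (- (s / 2)) * rGamma (s / 2) * ?P s"
  proof (rule L_eq_continuation[OF M])
    show "b h u (m + int (4 * h)) = b h u m" for m
      using b_periodic[OF h u, of m] by simp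
    show "(\<lambda>s. of_real (real (4 * h) / pi) powr (- (s / 2)) * rGamma (s / 2) * ?P s) holomorphic_on UNIV"
      using h by (intro holomorphic_intros hol holomorphic_rGamma') auto
    fix s :: complex assume s: "Re s > 1"
    from theta_mellin(2)[where f = "b h u" and B = 1, OF M bound s]
    show "(\<lambda>n. b h u (int (Suc n)) * of_nat (Suc n) powr (- s)) sums
        (of_real (real (4 * h) / pi) powr (- (s / 2)) * rGamma (s / 2) * ?P s)"
      by (simp only: mellin_theta_def powr_minus rGamma_inverse_Gamma inverse_mult_distrib divide_inverse mult_ac)
  qed
qed

text \<open>
  Off the isolated poles of the Gamma factor the product defining \<open>Lambda\<close> equals the entire function
  \<open>mellin_theta\<close>, so its limits exist everywhere and are the values of that function.
\<close>
lemma Lambda_eq_mellin_theta: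
  assumes h: "h > 0" "even h" and uv: "2 * int h dvd v * u + 1"
  shows "Lambda h u = mellin_theta (4 * h) (b h u)"
proof
  fix s :: complex
  let ?P = "mellin_theta (4 * h) (b h u)"
  have hol: "?P holomorphic_on UNIV" by (rule holomorphic_mellin_theta_b[OF h uv])
  have "\<forall>\<^sub>F z in at s. rGamma (z / 2) \<noteq> 0 \<and> z \<in> UNIV"
  proof (rule non_zero_neighbour_alt[of "\<lambda>z. rGamma (z / 2)" UNIV s 2])
    show "(\<lambda>z. rGamma (z / 2)) holomorphic_on UNIV"
      by (intro holomorphic_rGamma' holomorphic_intros) auto
  qed auto
  hence "\<forall>\<^sub>F z in at s. of_real (real (4 * h) / pi) powr (z / 2) * Gamma (z / 2) * L (4 * h) (b h u) z = ?P z"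
  proof eventually_elim
    case (elim z)
    have "complex_of_real (real (4 * h) / pi) powr (z / 2) \<noteq> 0" using h by simp
    thus ?case using elim unfolding L_b[OF h uv]
      by (simp add: powr_minus rGamma_inverse_Gamma field_simps)
  qed
  moreover have "?P \<midarrow>s\<rightarrow> ?P s"
    using holomorphic_on_imp_continuous_on[OF hol] by (simp add: continuous_on_def)
  ultimately have "(\<lambda>z. of_real (real (4 * h) / pi) powr (z / 2) * Gamma (z / 2) * L (4 * h) (b h u) z) \<midarrow>s\<rightarrow> ?P s"
    by (simp add: tendsto_cong)
  thus "Lambda h u s = ?P s"
    unfolding Lambda_def by (rule remove_sings_eqI)
qed

text \<open>
  With \<open>z = n + 1\<close>, reflection turns \<open>rGamma (- n - 1/2)\<close> into \<open>Gamma (z + 1/2)\<close> and duplication evaluates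
  \<open>Gamma z * Gamma (z + 1/2)\<close>.
\<close>
lemma rGamma_mult_Gamma_negative_odd:
  "rGamma ((- 2 * of_nat n - 1) / 2) * Gamma (of_nat n + 1)
     = (- 1) ^ (n + 1) * (of_real (fact (2 * n + 1) / (2 ^ (2 * n + 1) * sqrt pi)) :: complex)"
proof -
  define z :: complex where "z = of_nat n + 1"
  have z: "z \<notin> \<int>\<^sub>\<le>\<^sub>0" "z + 1 / 2 \<notin> \<int>\<^sub>\<le>\<^sub>0"
    by (auto simp: z_def elim!: nonpos_Ints_cases dest!: arg_cong[of _ _ Re])
  have "rGamma (z + 1 / 2) * rGamma (1 - (z + 1 / 2)) = sin (of_real pi * (z + 1 / 2)) / of_real pi"
    by (rule rGamma_reflection_complex)
  also have "1 - (z + 1 / 2) = (- 2 * of_nat n - 1) / 2" by (simp add: z_def field_simps)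
  also have "sin (of_real pi * (z + 1 / 2)) = (- 1) ^ (n + 1)"
  proof -
    have "of_real pi * (z + 1 / 2) = of_real (pi / 2 + real (n + 1) * pi)"
      by (simp add: z_def field_simps)
    also have "sin (complex_of_real (pi / 2 + real (n + 1) * pi)) = of_real (cos (real (n + 1) * pi))"
      by (simp only: sin_of_real) (simp add: sin_add)
    also have "cos (real (n + 1) * pi) = (- 1) ^ (n + 1)" by (rule cos_npi)
    finally show ?thesis by simp
  qed
  finally have reflection: "rGamma (z + 1 / 2) * rGamma ((- 2 * of_nat n - 1) / 2) = (- 1) ^ (n + 1) / of_real pi" .
  have "rGamma (z + 1 / 2) * Gamma (z + 1 / 2) = 1"
    using z(2) by (simp add: rGamma_inverse_Gamma Gamma_eq_zero_iff)
  hence "rGamma ((- 2 * of_nat n - 1) / 2)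
      = rGamma (z + 1 / 2) * rGamma ((- 2 * of_nat n - 1) / 2) * Gamma (z + 1 / 2)"
    by (simp only: mult_ac) (simp only: mult_1_right mult.assoc[symmetric] mult_1_left)
  hence "rGamma ((- 2 * of_nat n - 1) / 2) = (- 1) ^ (n + 1) / of_real pi * Gamma (z + 1 / 2)"
    by (simp only: reflection)
  hence "rGamma ((- 2 * of_nat n - 1) / 2) * Gamma z
      = (- 1) ^ (n + 1) / of_real pi * (Gamma z * Gamma (z + 1 / 2))" by simp
  also have "Gamma z * Gamma (z + 1 / 2) = exp ((1 - 2 * z) * of_real (ln 2)) * of_real (sqrt pi) * Gamma (2 * z)"
    by (rule Gamma_legendre_duplication[OF z])
  also have "Gamma (2 * z) = fact (2 * n + 1)"
    using Gamma_fact[of "2 * n + 1", where ?'a = complex] by (simp add: z_def algebra_simps)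
  also have "(1 - 2 * z) * of_real (ln 2) = of_real (- (real (2 * n + 1) * ln 2))"
    by (simp add: z_def algebra_simps)
  also have "exp (complex_of_real (- (real (2 * n + 1) * ln 2))) = of_real (1 / 2 ^ (2 * n + 1))"
  proof -
    have "exp (- (real (2 * n + 1) * ln 2)) = inverse (exp (ln 2) ^ (2 * n + 1))"
      by (simp only: exp_minus exp_of_nat_mult)
    also have "\<dots> = 1 / 2 ^ (2 * n + 1)" by (simp add: inverse_eq_divide)
    finally show ?thesis by (simp only: exp_of_real)
  qed
  also have "(- 1) ^ (n + 1) / complex_of_real pi * (of_real (1 / 2 ^ (2 * n + 1)) * of_real (sqrt pi) * fact (2 * n + 1))
      = (- 1) ^ (n + 1) * of_real (fact (2 * n + 1) / (2 ^ (2 * n + 1) * sqrt pi))"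
  proof -
    define q where "q = complex_of_real (sqrt pi)"
    have q: "q \<noteq> 0" by (simp add: q_def)
    have "complex_of_real pi = of_real (sqrt pi * sqrt pi)" by simp
    also have "\<dots> = q * q" by (simp only: of_real_mult q_def)
    finally have pi: "complex_of_real pi = q * q" .
    show ?thesis unfolding of_real_divide of_real_mult of_real_power of_real_fact of_real_numeral of_real_1
        pi q_def[symmetric] using q by (simp add: divide_simps)
  qed
  finally show ?thesis by (simp add: z_def)
qed

text \<open>
  The functional equation at \<open>s = - 2 n - 1\<close>. The powers of \<open>A = M / \<pi>\<close> from the two sides combine to
  \<open>A ^ (2 n + 1) * sqrt A\<close>; the square roots cancel against those of \<open>omega\<close> and of the duplication
  formula, and \<open>A / 2 = 2 h / \<pi>\<close>.
\<close>
lemma L_b_negative_odd: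
  assumes h: "h > 0" "even h" and uv: "2 * int h dvd v * u + 1"
  shows "L (4 * h) (b h u) (- 2 * of_nat n - 1)
          = (-1) ^ (n + 1) * C h u
            * of_real (fact (2 * n + 1) * real (2 * h) ^ (2 * n + 1) / pi ^ (2 * n + 2))
            * L (4 * h) (b h v) (2 * of_nat n + 2)"
proof -
  have vu: "2 * int h dvd u * v + 1" using uv by (simp add: mult.commute)
  define s :: complex where "s = - 2 * of_nat n - 1"
  define A where "A = real (4 * h) / pi"
  have A: "A > 0" using h by (simp add: A_def)
  let ?P = "mellin_theta (4 * h) (b h v)"
  let ?L = "L (4 * h) (b h v) (2 * of_nat n + 2)"
  have s1: "1 - s = 2 * of_nat n + 2" by (simp add: s_def)
  have P: "?P (1 - s) = of_real A powr (of_nat n + 1) * Gamma (of_nat n + 1) * ?L"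
  proof -
    have half: "(2 * of_nat n + 2) / 2 = (of_nat n + 1 :: complex)" by (simp add: field_simps)
    have ne: "complex_of_real A powr (of_nat n + 1) \<noteq> 0" "Gamma (of_nat n + 1 :: complex) \<noteq> 0"
      using A by (auto simp: Gamma_eq_zero_iff elim!: nonpos_Ints_cases dest!: arg_cong[of _ _ Re])
    have "?L = inverse (of_real A powr (of_nat n + 1)) * inverse (Gamma (of_nat n + 1)) * ?P (1 - s)"
      unfolding s1 by (simp only: L_b[OF h vu] half A_def powr_minus rGamma_inverse_Gamma)
    thus ?thesis using ne by (simp add: field_simps)
  qed
  have "L (4 * h) (b h u) s = of_real A powr (- (s / 2)) * rGamma (s / 2) * (omega h u * ?P (1 - s))"
    unfolding L_b[OF h uv, of s] mellin_theta_b_functional_equation[OF h uv, of s] A_def ..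
  also have "\<dots> = (of_real A powr (- (s / 2)) * of_real A powr (of_nat n + 1)) * omega h u
      * (rGamma ((- 2 * of_nat n - 1) / 2) * Gamma (of_nat n + 1)) * ?L"
    unfolding P by (simp add: s_def mult_ac)
  also have "of_real A powr (- (s / 2)) * of_real A powr (of_nat n + 1) = complex_of_real (A ^ (2 * n + 1) * sqrt A)"
  proof -
    have "of_real A powr (- (s / 2)) * of_real A powr (of_nat n + 1) = complex_of_real A powr (of_real (real (2 * n + 1) + 1 / 2))"
      unfolding powr_add[symmetric] by (simp add: s_def field_simps)
    also have "\<dots> = of_real (A powr (real (2 * n + 1) + 1 / 2))"
      using A by (intro powr_of_real) auto
    also have "A powr (real (2 * n + 1) + 1 / 2) = A ^ (2 * n + 1) * sqrt A"
      using A unfolding powr_add by (simp only: powr_realpow powr_half_sqrt less_imp_le)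
    finally show ?thesis .
  qed
  also have "complex_of_real (A ^ (2 * n + 1) * sqrt A) * omega h u
      * (rGamma ((- 2 * of_nat n - 1) / 2) * Gamma (of_nat n + 1)) * ?L
      = (- 1) ^ (n + 1) * C h u * of_real (fact (2 * n + 1) * (A / 2) ^ (2 * n + 1)
          * (sqrt A / (sqrt (real (4 * h)) * sqrt pi))) * ?L"
    unfolding rGamma_mult_Gamma_negative_odd omega_def
    by (simp add: power_divide field_simps)
  also have "sqrt A / (sqrt (real (4 * h)) * sqrt pi) = 1 / pi"
    using h by (simp add: A_def real_sqrt_divide field_simps)
  also have "fact (2 * n + 1) * (A / 2) ^ (2 * n + 1) * (1 / pi)
      = fact (2 * n + 1) * real (2 * h) ^ (2 * n + 1) / pi ^ (2 * n + 2)"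
  proof -
    have "A / 2 = real (2 * h) / pi" by (simp add: A_def)
    thus ?thesis by (simp add: power_divide)
  qed
  finally show ?thesis by (simp add: s_def)
qed

theorem theorem4p1:
  fixes h :: nat and \<alpha> :: int
  assumes "h \<ge> 2" and "even h"
    and "\<alpha> \<in> Units (residue_ring (2 * int h))"
  shows "Lambda h \<alpha> holomorphic_on UNIV
    \<and> (\<forall>s. Lambda h \<alpha> s = omega h \<alpha> * Lambda h (dual h \<alpha>) (1 - s))
    \<and> norm (omega h \<alpha>) = 1
    \<and> omega h \<alpha> * omega h (dual h \<alpha>) = 1
    \<and> is_minimal_period (b h \<alpha>) (4 * h)
    \<and> (\<forall>n::nat. L (4 * h) (b h \<alpha>) (- 2 * of_nat n - 1)
          = (-1) ^ (n + 1) * C h \<alpha>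
            * of_real (fact (2 * n + 1) * real (2 * h) ^ (2 * n + 1) / pi ^ (2 * n + 2))
            * L (4 * h) (b h (dual h \<alpha>)) (2 * of_nat n + 2))"
proof -
  have h: "h > 0" "even h" using assms by auto
  have uv: "2 * int h dvd dual h \<alpha> * \<alpha> + 1" by (rule dual_cong[OF h(1) assms(3)])
  hence vu: "2 * int h dvd \<alpha> * dual h \<alpha> + 1" by (simp add: mult.commute)
  have "norm (omega h \<alpha>) = 1"
    using h by (simp add: omega_def norm_divide norm_C[OF h uv])
  moreover have "omega h \<alpha> * omega h (dual h \<alpha>) = 1"
  proof -
    have "omega h \<alpha> * omega h (dual h \<alpha>)
        = C h \<alpha> * C h (dual h \<alpha>) / of_real (sqrt (real (4 * h)) * sqrt (real (4 * h)))"
      unfolding omega_def of_real_mult by (simp only: times_divide_times_eq)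
    also have "\<dots> = 1" unfolding C_mult_C_dual[OF h uv] real_sqrt_mult_self using h by simp
    finally show ?thesis .
  qed
  ultimately show ?thesis
    unfolding Lambda_eq_mellin_theta[OF h uv] Lambda_eq_mellin_theta[OF h vu]
    using holomorphic_mellin_theta_b[OF h uv] mellin_theta_b_functional_equation[OF h uv]
      minimal_period_b[OF h uv] L_b_negative_odd[OF h uv]
    by blast
qed

end
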